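(* Let $(E_1,M,\rho_1,[\cdot,\dots,\cdot]_1)$ and $(E_2,N,\rho_2,[\cdot,\dots,\cdot]_2)$ be $n$-Lie algebroids, $\phi:M\to N$ a smooth map, $\Phi_E:\phi^!E_2\to E_1$ a vector bundle morphism over $M$ with induced map $\Phi_E^*:\Gamma(E_2)\to\Gamma(E_1)$, and let $\psi=\phi^*:C^\infty(N)\to C^\infty(M)$. Then condition (i) $\phi_*\circ\rho_1\circ\Phi_E^*=\rho_2$ in the definition of a comorphism of $n$-Lie algebroids is equivalent to $$\psi([\sigma_1,\dots,\sigma_{n-1},f]_{2})=[\Phi_E^*(\sigma_1),\dots,\Phi_E^*(\sigma_{n-1}),\psi(f)]_{1}\qquad\text{for all }\sigma_1,\dots,\sigma_{n-1}\in\Gamma(E_2),\ f\in C^\infty(N).$$ Consequently, $\Phi_E$ is a comorphism of $n$-Lie algebroids if and only if $(\Phi_E^*,\psi)$ is a morphism of $n$-Lie-Rinehart algebras from $(\Gamma(E_2),C^\infty(N))$ to $(\Gamma(E_1),C^\infty(M))$.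
   Context: An $n$-Lie algebroid $(E,M,\rho,[\cdot,\dots,\cdot])$ is a vector bundle $E\to M$ with a skew-symmetric $\mathbb{R}$-multilinear $n$-bracket on $\Gamma(E)$ and a vector bundle map $\rho:\wedge^{n-1}E\to TM$ (anchor) such that $\Gamma(E)$ is an $n$-Lie algebra, i.e. $[X_1,\dots,X_{n-1},[Y_1,\dots,Y_n]]=\sum_{i=1}^n[Y_1,\dots,[X_1,\dots,X_{n-1},Y_i],\dots,Y_n]$; $[\rho(X_1,\dots,X_{n-1}),\rho(Y_1,\dots,Y_{n-1})]=\sum_i\rho(Y_1,\dots,[X_1,\dots,X_{n-1},Y_i],\dots,Y_{n-1})$; and $[X_1,\dots,X_{n-1},fX_n]=f[X_1,\dots,X_n]+\rho(X_1,\dots,X_{n-1})(f)X_n$. For a function $f$ one writes $[X_1,\dots,X_{n-1},f]:=\rho(X_1\wedge\cdots\wedge X_{n-1})(f)$. The sections $\Gamma(E)$ are regarded as an $n$-Lie-Rinehart algebra over $C^\infty(M)$ with this bracket and anchor. $\phi^!E_2$ is the pull-back bundle over $M$; $\Phi_E^*:\Gamma(E_2)\to\Gamma(E_1)$ is $(\Phi_E^*\sigma)(x)=\Phi_E(\sigma(\phi(x)))$. $\Phi_E$ is a comorphism of $n$-Lie algebroids if (i) $\phi_*\circ\rho_1\circ\Phi_E^*=\rho_2$, meaning that for all $\sigma_1,\dots,\sigma_{n-1}\in\Gamma(E_2)$ the vector field $\rho_1(\Phi_E^*\sigma_1\wedge\cdots\wedge\Phi_E^*\sigma_{n-1})$ is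 $\phi$-related to $\rho_2(\sigma_1\wedge\cdots\wedge\sigma_{n-1})$; and (ii) $\Phi_E^*$ preserves the $n$-brackets. A morphism of $n$-Lie-Rinehart algebras from $(\mathbf{E},\mathcal{A})$ to $(\mathbf{F},\mathcal{B})$ is a pair $(\Psi,\psi)$ with $\psi:\mathcal{A}\to\mathcal{B}$ an algebra homomorphism and $\Psi:\mathbf{E}\to\mathbf{F}$ an $\mathcal{A}$-module map ($\mathbf{F}$ being an $\mathcal{A}$-module via $\psi$) such that $\psi([X_1,\dots,X_{n-1},a]_{\mathbf{E}})=[\Psi(X_1),\dots,\Psi(X_{n-1}),\psi(a)]_{\mathbf{F}}$ and $\Psi([X_1,\dots,X_n]_{\mathbf{E}})=[\Psi(X_1),\dots,\Psi(X_n)]_{\mathbf{F}}$ for all $X_i\in\mathbf{E}$, $a\in\mathcal{A}$. *)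

theory Defs
  imports "HOL-Analysis.Analysis" "HOL-Algebra.Module"
begin

section \<open>Smooth functions on open subsets of Euclidean space\<close>

text \<open>The model of m-dimensional space is the library's \<^term>\<open>Euclidean_space m\<close>: functions
  \<open>nat \<Rightarrow> real\<close> vanishing from index \<open>m\<close> on. The dimension is thus a number (possibly 0), not a type.\<close>

definition partial_deriv :: "nat \<Rightarrow> ((nat \<Rightarrow> real) \<Rightarrow> real) \<Rightarrow> (nat \<Rightarrow> real) \<Rightarrow> real" where
  "partial_deriv i f y = deriv (\<lambda>t. f (y(i := t))) (y i)"

text \<open>\<open>Ck m k V f\<close>: all partial derivatives of \<open>f\<close> up to order \<open>k\<close> exist and are continuous on \<open>V\<close>,
  for \<open>V\<close> open in \<^term>\<open>Euclidean_space m\<close>.\<close>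

primrec Ck :: "nat \<Rightarrow> nat \<Rightarrow> (nat \<Rightarrow> real) set \<Rightarrow> ((nat \<Rightarrow> real) \<Rightarrow> real) \<Rightarrow> bool" where
  "Ck m 0 V f \<longleftrightarrow> continuous_map (subtopology (Euclidean_space m) V) euclideanreal f"
| "Ck m (Suc k) V f \<longleftrightarrow>
     continuous_map (subtopology (Euclidean_space m) V) euclideanreal f \<and>
     (\<forall>i<m. (\<forall>y\<in>V. (\<lambda>t. f (y(i := t))) differentiable (at (y i))) \<and>
            Ck m k V (partial_deriv i f))"

definition smooth_on_Euclidean :: "nat \<Rightarrow> (nat \<Rightarrow> real) set \<Rightarrow> ((nat \<Rightarrow> real) \<Rightarrow> real) \<Rightarrow> bool" where
  "smooth_on_Euclidean m V f \<longleftrightarrow> (\<forall>k. Ck m k V f)"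


section \<open>Smooth manifolds\<close>

text \<open>The atlas need not be maximal; nothing below depends on the choice of atlas within a
  smooth structure.\<close>

record 'm mfd =
  mfd_top :: "'m topology"
  mfd_dim :: nat
  mfd_atlas :: "('m set \<times> ('m \<Rightarrow> nat \<Rightarrow> real)) set"

abbreviation points :: "'m mfd \<Rightarrow> 'm set" where
  "points M \<equiv> topspace (mfd_top M)"

definition smooth_manifold :: "'m mfd \<Rightarrow> bool" where
  "smooth_manifold M \<longleftrightarrow>
     Hausdorff_space (mfd_top M) \<and> second_countable (mfd_top M) \<and>
     \<Union>(fst ` mfd_atlas M) = points M \<and>
     (\<forall>(U,\<xi>)\<in>mfd_atlas M.
        openin (mfd_top M) U \<and> openin (Euclidean_space (mfd_dim M)) (\<xi> ` U) \<and>
        homeomorphic_map (subtopology (mfd_top M) U)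
          (subtopology (Euclidean_space (mfd_dim M)) (\<xi> ` U)) \<xi>) \<and>
     (\<forall>(U,\<xi>)\<in>mfd_atlas M. \<forall>(V,\<eta>)\<in>mfd_atlas M. \<forall>i<mfd_dim M.
        smooth_on_Euclidean (mfd_dim M) (\<xi> ` (U \<inter> V)) (\<lambda>y. \<eta> (inv_into U \<xi> y) i))"

text \<open>Smoothness of a real function on an open subset \<open>W\<close> of \<open>M\<close>.\<close>

definition smooth_real :: "'m mfd \<Rightarrow> 'm set \<Rightarrow> ('m \<Rightarrow> real) \<Rightarrow> bool" where
  "smooth_real M W f \<longleftrightarrow>
     (\<forall>(U,\<xi>)\<in>mfd_atlas M.
        smooth_on_Euclidean (mfd_dim M) (\<xi> ` (U \<inter> W)) (\<lambda>y. f (inv_into U \<xi> y)))"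

text \<open>Functions, vector fields and sections are extensional: they are \<^const>\<open>undefined\<close> outside the
  point set of \<open>M\<close>, so that HOL equality is equality on \<open>M\<close>.\<close>

definition Cinf :: "'m mfd \<Rightarrow> ('m \<Rightarrow> real) set" where
  "Cinf M = {f \<in> extensional (points M). smooth_real M (points M) f}"

definition smooth_map :: "'m mfd \<Rightarrow> 'n mfd \<Rightarrow> ('m \<Rightarrow> 'n) \<Rightarrow> bool" where
  "smooth_map M N \<phi> \<longleftrightarrow>
     continuous_map (mfd_top M) (mfd_top N) \<phi> \<and>
     (\<forall>(V,\<eta>)\<in>mfd_atlas N. \<forall>i<mfd_dim N.
        smooth_real M {x \<in> points M. \<phi> x \<in> V} (\<lambda>x. \<eta> (\<phi> x) i))"

definition pullback_fun :: "'m mfd \<Rightarrow> ('m \<Rightarrow> 'n) \<Rightarrow> ('n \<Rightarrow> real) \<Rightarrow> ('m \<Rightarrow> real)" where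
  "pullback_fun M \<phi> f = (\<lambda>x\<in>points M. f (\<phi> x))"

definition Cinf_algebra :: "'m mfd \<Rightarrow> (real, 'm \<Rightarrow> real) module" where
  "Cinf_algebra M =
     \<lparr>carrier = Cinf M,
      mult = (\<lambda>f g. \<lambda>x\<in>points M. f x * g x), one = (\<lambda>x\<in>points M. 1),
      zero = (\<lambda>x\<in>points M. 0), add = (\<lambda>f g. \<lambda>x\<in>points M. f x + g x),
      smult = (\<lambda>c f. \<lambda>x\<in>points M. c * f x)\<rparr>"


section \<open>Linear and skew-symmetric multilinear maps\<close>

text \<open>Real vector spaces are given by the record of a module with scalar type \<^typ>\<open>real\<close>;
  the ring multiplication in that record is not used.\<close>

definition linear_map ::
  "('s, 'x, 'p) module_scheme \<Rightarrow> ('s, 'y, 'q) module_scheme \<Rightarrow> ('x \<Rightarrow> 'y) \<Rightarrow> bool" where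
  "linear_map V W f \<longleftrightarrow>
     f \<in> carrier V \<rightarrow> carrier W \<and>
     (\<forall>x\<in>carrier V. \<forall>y\<in>carrier V. f (x \<oplus>\<^bsub>V\<^esub> y) = f x \<oplus>\<^bsub>W\<^esub> f y) \<and>
     (\<forall>c. \<forall>x\<in>carrier V. f (c \<odot>\<^bsub>V\<^esub> x) = c \<odot>\<^bsub>W\<^esub> f x)"

text \<open>A map of \<open>k\<close> arguments is a function on lists of length \<open>k\<close>.\<close>

definition args :: "nat \<Rightarrow> 'x set \<Rightarrow> 'x list set" where
  "args k A = {xs. length xs = k \<and> set xs \<subseteq> A}"

definition skew_multilinear ::
  "nat \<Rightarrow> (real, 'x, 'p) module_scheme \<Rightarrow> (real, 'y, 'q) module_scheme \<Rightarrow> ('x list \<Rightarrow> 'y) \<Rightarrow> bool" where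
  "skew_multilinear k V W f \<longleftrightarrow>
     (\<forall>xs\<in>args k (carrier V).
        (\<forall>i<k. linear_map V W (\<lambda>x. f (xs[i := x]))) \<and>
        (\<forall>i<k. \<forall>j<k. i \<noteq> j \<longrightarrow> f (xs[i := xs ! j, j := xs ! i]) = (-1) \<odot>\<^bsub>W\<^esub> f xs))"

definition coordinate_space :: "nat \<Rightarrow> (real, nat \<Rightarrow> real) module" where
  "coordinate_space r =
     \<lparr>carrier = topspace (Euclidean_space r), mult = undefined, one = undefined,
      zero = (\<lambda>i. 0), add = (\<lambda>a b i. a i + b i), smult = (\<lambda>c a i. c * a i)\<rparr>"

definition unit_vec :: "nat \<Rightarrow> nat \<Rightarrow> real" where
  "unit_vec j = (\<lambda>i. if i = j then 1 else 0)"


section \<open>Smooth vector bundles\<close>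

text \<open>A smooth vector bundle of rank \<open>r\<close> is given by a vector bundle atlas: local trivialisations
  \<open>(U, t)\<close> whose fibre component \<open>t\<close> maps each fibre over \<open>U\<close> isomorphically onto r-dimensional
  space, with smooth transition matrices. The topology and smooth structure of the total space are
  determined by these data, and so they are not recorded; likewise the vector space axioms hold in
  the fibres since they are transported along \<open>t\<close>.\<close>

record ('m, 'e) vbundle =
  vb_total :: "'e set"
  vb_proj :: "'e \<Rightarrow> 'm"
  vb_zero :: "'m \<Rightarrow> 'e"
  vb_add :: "'e \<Rightarrow> 'e \<Rightarrow> 'e"
  vb_scale :: "real \<Rightarrow> 'e \<Rightarrow> 'e"
  vb_rank :: nat
  vb_trivs :: "('m set \<times> ('e \<Rightarrow> nat \<Rightarrow> real)) set"

definition fibre :: "('m, 'e) vbundle \<Rightarrow> 'm \<Rightarrow> (real, 'e) module" where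
  "fibre E x =
     \<lparr>carrier = {e \<in> vb_total E. vb_proj E e = x}, mult = undefined, one = undefined,
      zero = vb_zero E x, add = vb_add E, smult = vb_scale E\<rparr>"

text \<open>The \<open>j\<close>-th member at \<open>x\<close> of the local frame belonging to a trivialisation.\<close>

definition frame :: "('m, 'e) vbundle \<Rightarrow> ('e \<Rightarrow> nat \<Rightarrow> real) \<Rightarrow> nat \<Rightarrow> 'm \<Rightarrow> 'e" where
  "frame E t j x = inv_into (carrier (fibre E x)) t (unit_vec j)"

definition vector_bundle :: "'m mfd \<Rightarrow> ('m, 'e) vbundle \<Rightarrow> bool" where
  "vector_bundle M E \<longleftrightarrow>
     vb_proj E \<in> vb_total E \<rightarrow> points M \<and>
     (\<forall>x\<in>points M.
        vb_zero E x \<in> carrier (fibre E x) \<and>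
        (\<forall>e\<in>carrier (fibre E x). \<forall>e'\<in>carrier (fibre E x). vb_add E e e' \<in> carrier (fibre E x)) \<and>
        (\<forall>c. \<forall>e\<in>carrier (fibre E x). vb_scale E c e \<in> carrier (fibre E x))) \<and>
     \<Union>(fst ` vb_trivs E) = points M \<and>
     (\<forall>(U,t)\<in>vb_trivs E.
        openin (mfd_top M) U \<and>
        (\<forall>x\<in>U. bij_betw t (carrier (fibre E x)) (carrier (coordinate_space (vb_rank E))) \<and>
               linear_map (fibre E x) (coordinate_space (vb_rank E)) t \<and>
               t (vb_zero E x) = (\<lambda>i. 0))) \<and>
     (\<forall>(U,t)\<in>vb_trivs E. \<forall>(V,s)\<in>vb_trivs E. \<forall>j<vb_rank E. \<forall>i<vb_rank E.
        smooth_real M (U \<inter> V) (\<lambda>x. s (frame E t j x) i))"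

text \<open>Smooth sections, as a real vector space and as a module over the smooth functions.\<close>

definition sections :: "'m mfd \<Rightarrow> ('m, 'e) vbundle \<Rightarrow> ('m \<Rightarrow> 'e) set" where
  "sections M E =
     {\<sigma> \<in> extensional (points M).
        (\<forall>x\<in>points M. \<sigma> x \<in> carrier (fibre E x)) \<and>
        (\<forall>(U,t)\<in>vb_trivs E. \<forall>i<vb_rank E. smooth_real M U (\<lambda>x. t (\<sigma> x) i))}"

definition section_space :: "'m mfd \<Rightarrow> ('m, 'e) vbundle \<Rightarrow> (real, 'm \<Rightarrow> 'e) module" where
  "section_space M E =
     \<lparr>carrier = sections M E, mult = undefined, one = undefined,
      zero = (\<lambda>x\<in>points M. vb_zero E x),
      add = (\<lambda>\<sigma> \<tau>. \<lambda>x\<in>points M. vb_add E (\<sigma> x) (\<tau> x)),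
      smult = (\<lambda>c \<sigma>. \<lambda>x\<in>points M. vb_scale E c (\<sigma> x))\<rparr>"

definition section_module :: "'m mfd \<Rightarrow> ('m, 'e) vbundle \<Rightarrow> ('m \<Rightarrow> real, 'm \<Rightarrow> 'e) module" where
  "section_module M E =
     \<lparr>carrier = sections M E, mult = undefined, one = undefined,
      zero = (\<lambda>x\<in>points M. vb_zero E x),
      add = (\<lambda>\<sigma> \<tau>. \<lambda>x\<in>points M. vb_add E (\<sigma> x) (\<tau> x)),
      smult = (\<lambda>f \<sigma>. \<lambda>x\<in>points M. vb_scale E (f x) (\<sigma> x))\<rparr>"

text \<open>Vector bundle morphisms over the identity of \<open>M\<close>: fibrewise linear, with smooth local
  matrices.\<close>

definition bundle_map :: "'m mfd \<Rightarrow> ('m, 'e) vbundle \<Rightarrow> ('m, 'f) vbundle \<Rightarrow> ('e \<Rightarrow> 'f) \<Rightarrow> bool" where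
  "bundle_map M E F \<Phi> \<longleftrightarrow>
     (\<forall>x\<in>points M. linear_map (fibre E x) (fibre F x) \<Phi>) \<and>
     (\<forall>(U,t)\<in>vb_trivs E. \<forall>(V,s)\<in>vb_trivs F. \<forall>j<vb_rank E. \<forall>i<vb_rank F.
        smooth_real M (U \<inter> V) (\<lambda>x. s (\<Phi> (frame E t j x)) i))"

text \<open>A vector bundle morphism from the k-th exterior power of \<open>E\<close> (with \<open>k \<ge> 1\<close>) to \<open>F\<close>, through the
  universal property of the exterior power: \<open>\<rho> [e\<^sub>1, \<dots>, e\<^sub>k]\<close> is the value on the wedge product of the
  \<open>e\<^sub>i\<close>. Wedges of frame members span the exterior power, so smoothness is again that of the local
  matrices.\<close>

definition exterior_bundle_map ::
  "'m mfd \<Rightarrow> nat \<Rightarrow> ('m, 'e) vbundle \<Rightarrow> ('m, 'f) vbundle \<Rightarrow> ('e list \<Rightarrow> 'f) \<Rightarrow> bool" where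
  "exterior_bundle_map M k E F \<rho> \<longleftrightarrow>
     (\<forall>x\<in>points M. skew_multilinear k (fibre E x) (fibre F x) \<rho>) \<and>
     (\<forall>(U,t)\<in>vb_trivs E. \<forall>(V,s)\<in>vb_trivs F. \<forall>js\<in>args k {..<vb_rank E}. \<forall>i<vb_rank F.
        smooth_real M (U \<inter> V) (\<lambda>x. s (\<rho> (map (\<lambda>j. frame E t j x) js)) i))"

definition pullback_bundle ::
  "'m mfd \<Rightarrow> ('m \<Rightarrow> 'n) \<Rightarrow> ('n, 'e) vbundle \<Rightarrow> ('m, 'm \<times> 'e) vbundle" where
  "pullback_bundle M \<phi> E =
     \<lparr>vb_total = {(x, e). x \<in> points M \<and> e \<in> vb_total E \<and> vb_proj E e = \<phi> x},
      vb_proj = fst,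
      vb_zero = (\<lambda>x. (x, vb_zero E (\<phi> x))),
      vb_add = (\<lambda>(x, e) (x', e'). (x, vb_add E e e')),
      vb_scale = (\<lambda>c (x, e). (x, vb_scale E c e)),
      vb_rank = vb_rank E,
      vb_trivs = (\<lambda>(U, t). ({x \<in> points M. \<phi> x \<in> U}, \<lambda>(x, e). t e)) ` vb_trivs E\<rparr>"


section \<open>Tangent bundle and vector fields\<close>

definition tangent_space :: "'m mfd \<Rightarrow> 'm \<Rightarrow> (('m \<Rightarrow> real) \<Rightarrow> real) set" where
  "tangent_space M p =
     {v \<in> extensional (Cinf M).
        (\<forall>f\<in>Cinf M. \<forall>g\<in>Cinf M. v (f \<oplus>\<^bsub>Cinf_algebra M\<^esub> g) = v f + v g) \<and>
        (\<forall>c. \<forall>f\<in>Cinf M. v (c \<odot>\<^bsub>Cinf_algebra M\<^esub> f) = c * v f) \<and>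
        (\<forall>f\<in>Cinf M. \<forall>g\<in>Cinf M. v (f \<otimes>\<^bsub>Cinf_algebra M\<^esub> g) = f p * v g + g p * v f)}"

text \<open>Elements of the tangent bundle are pairs of a base point and a derivation at that point. The
  trivialisation belonging to a chart \<open>(U, \<xi>)\<close> maps a derivation to its coefficients with respect to
  the coordinate derivations of \<open>\<xi>\<close>.\<close>

definition tangent_coords ::
  "'m mfd \<Rightarrow> 'm set \<Rightarrow> ('m \<Rightarrow> nat \<Rightarrow> real) \<Rightarrow> 'm \<times> (('m \<Rightarrow> real) \<Rightarrow> real) \<Rightarrow> nat \<Rightarrow> real" where
  "tangent_coords M U \<xi> = (\<lambda>(p, v).
     THE a. a \<in> topspace (Euclidean_space (mfd_dim M)) \<and>
       (\<forall>f\<in>Cinf M.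
          v f = (\<Sum>i<mfd_dim M. a i * partial_deriv i (\<lambda>y. f (inv_into U \<xi> y)) (\<xi> p))))"

definition tangent_bundle :: "'m mfd \<Rightarrow> ('m, 'm \<times> (('m \<Rightarrow> real) \<Rightarrow> real)) vbundle" where
  "tangent_bundle M =
     \<lparr>vb_total = (SIGMA p:points M. tangent_space M p),
      vb_proj = fst,
      vb_zero = (\<lambda>p. (p, \<lambda>f\<in>Cinf M. 0)),
      vb_add = (\<lambda>(p, v) (q, w). (p, \<lambda>f\<in>Cinf M. v f + w f)),
      vb_scale = (\<lambda>c (p, v). (p, \<lambda>f\<in>Cinf M. c * v f)),
      vb_rank = mfd_dim M,
      vb_trivs = (\<lambda>(U, \<xi>). (U, tangent_coords M U \<xi>)) ` mfd_atlas M\<rparr>"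

type_synonym 'm vector_field = "'m \<Rightarrow> 'm \<times> (('m \<Rightarrow> real) \<Rightarrow> real)"

definition vf_apply :: "'m mfd \<Rightarrow> 'm vector_field \<Rightarrow> ('m \<Rightarrow> real) \<Rightarrow> ('m \<Rightarrow> real)" where
  "vf_apply M X f = (\<lambda>p\<in>points M. snd (X p) f)"

definition lie_bracket :: "'m mfd \<Rightarrow> 'm vector_field \<Rightarrow> 'm vector_field \<Rightarrow> 'm vector_field" where
  "lie_bracket M X Y =
     (\<lambda>p\<in>points M. (p, \<lambda>f\<in>Cinf M. snd (X p) (vf_apply M Y f) - snd (Y p) (vf_apply M X f)))"

definition tangent_map ::
  "'m mfd \<Rightarrow> 'n mfd \<Rightarrow> ('m \<Rightarrow> 'n) \<Rightarrow> 'm \<times> (('m \<Rightarrow> real) \<Rightarrow> real) \<Rightarrow> 'n \<times> (('n \<Rightarrow> real) \<Rightarrow> real)" where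
  "tangent_map M N \<phi> = (\<lambda>(p, v). (\<phi> p, \<lambda>f\<in>Cinf N. v (pullback_fun M \<phi> f)))"

definition related ::
  "'m mfd \<Rightarrow> 'n mfd \<Rightarrow> ('m \<Rightarrow> 'n) \<Rightarrow> 'm vector_field \<Rightarrow> 'n vector_field \<Rightarrow> bool" where
  "related M N \<phi> X Y \<longleftrightarrow> (\<forall>x\<in>points M. tangent_map M N \<phi> (X x) = Y (\<phi> x))"


section \<open>n-Lie algebroids\<close>

definition n_Lie_algebra :: "nat \<Rightarrow> (real, 'x) module \<Rightarrow> ('x list \<Rightarrow> 'x) \<Rightarrow> bool" where
  "n_Lie_algebra n V br \<longleftrightarrow>
     skew_multilinear n V V br \<and>
     (\<forall>Xs\<in>args (n - 1) (carrier V). \<forall>Ys\<in>args n (carrier V).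
        br (Xs @ [br Ys]) = finsum V (\<lambda>i. br (Ys[i := br (Xs @ [Ys ! i])])) {..<n})"

definition anchor_field ::
  "'m mfd \<Rightarrow> ('e list \<Rightarrow> 'm \<times> (('m \<Rightarrow> real) \<Rightarrow> real)) \<Rightarrow> ('m \<Rightarrow> 'e) list \<Rightarrow> 'm vector_field" where
  "anchor_field M \<rho> Xs = (\<lambda>x\<in>points M. \<rho> (map (\<lambda>X. X x) Xs))"

text \<open>The bracket \<open>[X\<^sub>1, \<dots>, X\<^sub>n\<^sub>-\<^sub>1, f]\<close> of sections with a function.\<close>

definition fun_bracket ::
  "'m mfd \<Rightarrow> ('e list \<Rightarrow> 'm \<times> (('m \<Rightarrow> real) \<Rightarrow> real)) \<Rightarrow> ('m \<Rightarrow> 'e) list \<Rightarrow> ('m \<Rightarrow> real) \<Rightarrow> ('m \<Rightarrow> real)" where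
  "fun_bracket M \<rho> Xs f = vf_apply M (anchor_field M \<rho> Xs) f"

definition n_Lie_algebroid ::
  "nat \<Rightarrow> 'm mfd \<Rightarrow> ('m, 'e) vbundle \<Rightarrow> ('e list \<Rightarrow> 'm \<times> (('m \<Rightarrow> real) \<Rightarrow> real)) \<Rightarrow>
     (('m \<Rightarrow> 'e) list \<Rightarrow> ('m \<Rightarrow> 'e)) \<Rightarrow> bool" where
  "n_Lie_algebroid n M E \<rho> br \<longleftrightarrow>
     n \<ge> 2 \<and> smooth_manifold M \<and> vector_bundle M E \<and>
     exterior_bundle_map M (n - 1) E (tangent_bundle M) \<rho> \<and>
     n_Lie_algebra n (section_space M E) br \<and>
     (\<forall>Xs\<in>args (n - 1) (sections M E). \<forall>Ys\<in>args (n - 1) (sections M E).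
        lie_bracket M (anchor_field M \<rho> Xs) (anchor_field M \<rho> Ys) =
        finsum (section_space M (tangent_bundle M))
          (\<lambda>i. anchor_field M \<rho> (Ys[i := br (Xs @ [Ys ! i])])) {..<n - 1}) \<and>
     (\<forall>Xs\<in>args (n - 1) (sections M E). \<forall>Y\<in>sections M E. \<forall>f\<in>Cinf M.
        br (Xs @ [f \<odot>\<^bsub>section_module M E\<^esub> Y]) =
        (f \<odot>\<^bsub>section_module M E\<^esub> br (Xs @ [Y]))
          \<oplus>\<^bsub>section_module M E\<^esub> (fun_bracket M \<rho> Xs f \<odot>\<^bsub>section_module M E\<^esub> Y))"


section \<open>Comorphisms\<close>

definition pullback_section ::
  "'m mfd \<Rightarrow> ('m \<Rightarrow> 'n) \<Rightarrow> ('m \<times> 'e \<Rightarrow> 'f) \<Rightarrow> ('n \<Rightarrow> 'e) \<Rightarrow> ('m \<Rightarrow> 'f)" where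
  "pullback_section M \<phi> \<Phi> \<sigma> = (\<lambda>x\<in>points M. \<Phi> (x, \<sigma> (\<phi> x)))"

definition anchor_compatible ::
  "nat \<Rightarrow> 'm mfd \<Rightarrow> ('e1 list \<Rightarrow> 'm \<times> (('m \<Rightarrow> real) \<Rightarrow> real)) \<Rightarrow>
   'n mfd \<Rightarrow> ('n, 'e2) vbundle \<Rightarrow> ('e2 list \<Rightarrow> 'n \<times> (('n \<Rightarrow> real) \<Rightarrow> real)) \<Rightarrow>
   ('m \<Rightarrow> 'n) \<Rightarrow> ('m \<times> 'e2 \<Rightarrow> 'e1) \<Rightarrow> bool" where
  "anchor_compatible n M \<rho>1 N E2 \<rho>2 \<phi> \<Phi> \<longleftrightarrow>
     (\<forall>\<sigma>s\<in>args (n - 1) (sections N E2).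
        related M N \<phi> (anchor_field M \<rho>1 (map (pullback_section M \<phi> \<Phi>) \<sigma>s))
          (anchor_field N \<rho>2 \<sigma>s))"

definition comorphism ::
  "nat \<Rightarrow> 'm mfd \<Rightarrow> ('m, 'e1) vbundle \<Rightarrow> ('e1 list \<Rightarrow> 'm \<times> (('m \<Rightarrow> real) \<Rightarrow> real)) \<Rightarrow>
     (('m \<Rightarrow> 'e1) list \<Rightarrow> ('m \<Rightarrow> 'e1)) \<Rightarrow>
   'n mfd \<Rightarrow> ('n, 'e2) vbundle \<Rightarrow> ('e2 list \<Rightarrow> 'n \<times> (('n \<Rightarrow> real) \<Rightarrow> real)) \<Rightarrow>
     (('n \<Rightarrow> 'e2) list \<Rightarrow> ('n \<Rightarrow> 'e2)) \<Rightarrow>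
   ('m \<Rightarrow> 'n) \<Rightarrow> ('m \<times> 'e2 \<Rightarrow> 'e1) \<Rightarrow> bool" where
  "comorphism n M E1 \<rho>1 br1 N E2 \<rho>2 br2 \<phi> \<Phi> \<longleftrightarrow>
     smooth_map M N \<phi> \<and> bundle_map M (pullback_bundle M \<phi> E2) E1 \<Phi> \<and>
     anchor_compatible n M \<rho>1 N E2 \<rho>2 \<phi> \<Phi> \<and>
     (\<forall>\<sigma>s\<in>args n (sections N E2).
        pullback_section M \<phi> \<Phi> (br2 \<sigma>s) = br1 (map (pullback_section M \<phi> \<Phi>) \<sigma>s))"


section \<open>n-Lie-Rinehart algebras\<close>

text \<open>The data of an n-Lie-Rinehart algebra: a real algebra, a module over it, the n-bracket, and the
  bracket \<open>[X\<^sub>1, \<dots>, X\<^sub>n\<^sub>-\<^sub>1, a]\<close> given by the anchor.\<close>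

record ('a, 'x) lie_rinehart =
  lr_algebra :: "(real, 'a) module"
  lr_module :: "('a, 'x) module"
  lr_bracket :: "'x list \<Rightarrow> 'x"
  lr_action :: "'x list \<Rightarrow> 'a \<Rightarrow> 'a"

definition lie_rinehart_morphism ::
  "nat \<Rightarrow> ('a, 'x) lie_rinehart \<Rightarrow> ('b, 'y) lie_rinehart \<Rightarrow> ('x \<Rightarrow> 'y) \<Rightarrow> ('a \<Rightarrow> 'b) \<Rightarrow> bool" where
  "lie_rinehart_morphism n L K \<Psi> \<psi> \<longleftrightarrow>
     \<psi> \<in> ring_hom (lr_algebra L) (lr_algebra K) \<and>
     linear_map (lr_algebra L) (lr_algebra K) \<psi> \<and>
     \<Psi> \<in> carrier (lr_module L) \<rightarrow> carrier (lr_module K) \<and>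
     (\<forall>X\<in>carrier (lr_module L). \<forall>Y\<in>carrier (lr_module L).
        \<Psi> (X \<oplus>\<^bsub>lr_module L\<^esub> Y) = \<Psi> X \<oplus>\<^bsub>lr_module K\<^esub> \<Psi> Y) \<and>
     (\<forall>a\<in>carrier (lr_algebra L). \<forall>X\<in>carrier (lr_module L).
        \<Psi> (a \<odot>\<^bsub>lr_module L\<^esub> X) = \<psi> a \<odot>\<^bsub>lr_module K\<^esub> \<Psi> X) \<and>
     (\<forall>Xs\<in>args (n - 1) (carrier (lr_module L)). \<forall>a\<in>carrier (lr_algebra L).
        \<psi> (lr_action L Xs a) = lr_action K (map \<Psi> Xs) (\<psi> a)) \<and>
     (\<forall>Xs\<in>args n (carrier (lr_module L)).
        \<Psi> (lr_bracket L Xs) = lr_bracket K (map \<Psi> Xs))"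

definition section_lie_rinehart ::
  "'m mfd \<Rightarrow> ('m, 'e) vbundle \<Rightarrow> ('e list \<Rightarrow> 'm \<times> (('m \<Rightarrow> real) \<Rightarrow> real)) \<Rightarrow>
     (('m \<Rightarrow> 'e) list \<Rightarrow> ('m \<Rightarrow> 'e)) \<Rightarrow> ('m \<Rightarrow> real, 'm \<Rightarrow> 'e) lie_rinehart" where
  "section_lie_rinehart M E \<rho> br =
     \<lparr>lr_algebra = Cinf_algebra M, lr_module = section_module M E,
      lr_bracket = br, lr_action = fun_bracket M \<rho>\<rparr>"

end

theory Submission
  imports Defs
begin

text \<open>The vector fields \<open>\<rho>\<^sub>1(\<Phi>\<^sup>*\<sigma>\<^sub>1, \<dots>)\<close> and \<open>\<rho>\<^sub>2(\<sigma>\<^sub>1, \<dots>)\<close> are \<open>\<phi>\<close>-related iff the two derivations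
  \<open>f \<mapsto> \<rho>\<^sub>1(\<Phi>\<^sup>*\<sigma>\<^sub>1, \<dots>)(f \<circ> \<phi>)\<close> and \<open>f \<mapsto> \<rho>\<^sub>2(\<sigma>\<^sub>1, \<dots>)(f) \<circ> \<phi>\<close> agree for every smooth \<open>f\<close>, because tangent
  vectors are derivations and the tangent map is precomposition with \<open>\<phi>\<^sup>*\<close>
  (\<open>related_iff_pullback_fun\<close>). Read off for the brackets with functions, this is the first
  equivalence.

  For the second one, anchor compatibility and preservation of the n-brackets are common to both sides
  by the first equivalence. What is left is that \<open>\<phi>\<^sup>*\<close> is always an algebra homomorphism and
  \<open>\<Phi>\<^sup>*\<close> always a module map along it. Their algebraic laws are pointwise; the substance is that they
  are well defined, i.e. that \<open>\<phi>\<^sup>*\<close> maps smooth functions to smooth functions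
  (\<open>pullback_fun_Cinf\<close>) and \<open>\<Phi>\<^sup>*\<close> maps smooth sections to smooth sections
  (\<open>pullback_section_in_sections\<close>).

  Both rest on the stability of smoothness under composition, sums and products. As smoothness means
  existence and continuity of all iterated partial derivatives, composition needs the chain rule for
  functions with continuous partial derivatives (\<open>has_derivative_along_curve\<close>); induction on the order
  then gives \<open>Ck_compose\<close>. Sections are reduced to functions by expanding a fibre element in a local
  frame (\<open>bundle_map_in_frame\<close>).\<close>

section \<open>Calculus with iterated partial derivatives\<close>

text \<open>The topology of \<^term>\<open>Euclidean_space m\<close> is inherited from a product of infinitely many lines. A
  basic product neighbourhood constrains only finitely many factors, and the factors from \<open>m\<close> on are
  constant \<open>0\<close>, so a single radius for the first \<open>m\<close> coordinates suffices.\<close>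

lemma openin_Euclidean_box:
  assumes "openin (Euclidean_space m) V" "p \<in> V"
  obtains \<delta> where "\<delta> > 0"
    "\<And>x. x \<in> topspace (Euclidean_space m) \<Longrightarrow> (\<And>i. i < m \<Longrightarrow> \<bar>x i - p i\<bar> < \<delta>) \<Longrightarrow> x \<in> V"
proof -
  obtain T where T: "openin (powertop_real UNIV) T" "V = T \<inter> topspace (Euclidean_space m)"
    using assms(1) unfolding Euclidean_space_def openin_subtopology topspace_Euclidean_space
    by (auto simp: Euclidean_space_def)
  have pT: "p \<in> T" "p \<in> topspace (Euclidean_space m)" using assms(2) T by auto
  obtain U where U: "finite {i. U i \<noteq> UNIV}" "\<And>i. open (U i)" "p \<in> PiE UNIV U" "PiE UNIV U \<subseteq> T"
    using product_topology_open_contains_basis[OF T(1) pT(1)] by auto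
  have "\<exists>r>0. \<forall>z. \<bar>z - p i\<bar> < r \<longrightarrow> z \<in> U i" for i
  proof -
    have "p i \<in> U i" using U(3) by auto
    then obtain r where "r > 0" "ball (p i) r \<subseteq> U i" using U(2) open_contains_ball by blast
    then show ?thesis
      by (intro exI[of _ r]) (auto simp: ball_def dist_real_def subset_iff abs_minus_commute)
  qed
  then obtain r where r: "\<And>i. r i > 0" "\<And>i z. \<bar>z - p i\<bar> < r i \<Longrightarrow> z \<in> U i" by metis
  show thesis
  proof
    show "Min (insert 1 (r ` {..<m})) > 0" using r(1) by auto
    fix x assume x: "x \<in> topspace (Euclidean_space m)"
      and lt: "\<And>i. i < m \<Longrightarrow> \<bar>x i - p i\<bar> < Min (insert 1 (r ` {..<m}))"
    have "x i \<in> U i" for i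
    proof (cases "i < m")
      case True
      then show ?thesis using lt[OF True] by (intro r(2)) auto
    next
      case False
      then have "x i = p i" using x pT(2) by (simp add: topspace_Euclidean_space)
      then show ?thesis using U(3) by auto
    qed
    then have "x \<in> T" using U(4) by auto
    then show "x \<in> V" using T(2) x by auto
  qed
qed

lemma fun_upd_in_Euclidean:
  "y \<in> topspace (Euclidean_space m) \<Longrightarrow> i < m \<Longrightarrow> y(i := t) \<in> topspace (Euclidean_space m)"
  by (auto simp: topspace_Euclidean_space)

lemma eventually_fun_upd_in_open:
  assumes "openin (Euclidean_space m) V" "y \<in> V" "i < m"
  shows "\<forall>\<^sub>F t in nhds (y i). y(i := t) \<in> V"
proof -
  obtain \<delta> where \<delta>: "\<delta> > 0"
    "\<And>x. x \<in> topspace (Euclidean_space m) \<Longrightarrow> (\<And>j. j < m \<Longrightarrow> \<bar>x j - y j\<bar> < \<delta>) \<Longrightarrow> x \<in> V"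
    using openin_Euclidean_box[OF assms(1,2)] by blast
  have yE: "y \<in> topspace (Euclidean_space m)" using assms(1,2) openin_subset by blast
  show ?thesis
    unfolding eventually_nhds_metric
    using \<delta> fun_upd_in_Euclidean[OF yE assms(3)]
    by (intro exI[of _ \<delta>]) (auto simp: dist_real_def)
qed

text \<open>The mean value theorem without an assumption on the order of the end points: along a curve the
  increment of a coordinate can have either sign, and can vanish.\<close>

lemma real_mean_value:
  fixes F F' :: "real \<Rightarrow> real"
  assumes "\<And>z. \<bar>z - a\<bar> \<le> \<bar>b - a\<bar> \<Longrightarrow> (F has_real_derivative F' z) (at z)"
  obtains z where "\<bar>z - a\<bar> \<le> \<bar>b - a\<bar>" "F b - F a = F' z * (b - a)"
proof (cases a b rule: linorder_cases)
  case less
  then obtain z where "z > a" "z < b" "F b - F a = (b - a) * F' z"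
    using MVT2[of a b F F'] assms by auto
  then show ?thesis using less by (intro that[of z]) auto
next
  case equal
  then show ?thesis by (intro that[of a]) auto
next
  case greater
  then obtain z where "z > b" "z < a" "F a - F b = (a - b) * F' z"
    using MVT2[of b a F F'] assms by auto
  then show ?thesis using greater by (intro that[of z]) (auto simp: algebra_simps)
qed

lemma Ck_has_partial_deriv:
  assumes "Ck m (Suc k) V f" "i < m" "y \<in> V"
  shows "((\<lambda>t. f (y(i := t))) has_real_derivative partial_deriv i f y) (at (y i))"
  using assms by (auto simp: partial_deriv_def DERIV_deriv_iff_real_differentiable)

text \<open>The chain rule along a curve that is merely differentiable at one point. The increment of \<open>f\<close> is
  split by exchanging one coordinate at a time, from \<open>c t0\<close> towards \<open>c t\<close>. Each exchange is governed
  by the mean value theorem for a single partial derivative, and continuity of that partial derivative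
  identifies the limit of the difference quotient.\<close>

lemma has_derivative_along_curve:
  fixes c :: "real \<Rightarrow> nat \<Rightarrow> real"
  assumes W: "openin (Euclidean_space n) W" "c t0 \<in> W"
    and f: "Ck n 1 W f"
    and cE: "\<forall>\<^sub>F t in nhds t0. c t \<in> topspace (Euclidean_space n)"
    and c': "\<And>j. j < n \<Longrightarrow> ((\<lambda>t. c t j) has_real_derivative c' j) (at t0)"
  shows "((\<lambda>t. f (c t)) has_real_derivative (\<Sum>j<n. partial_deriv j f (c t0) * c' j)) (at t0)"
proof -
  \<comment> \<open>the first \<open>k\<close> coordinates are moved to \<open>c t\<close>, the others remain at \<open>c t0\<close>\<close>
  define C where "C k t = (\<lambda>i. if i < k then c t i else c t0 i)" for k t
  have c0: "c t0 \<in> topspace (Euclidean_space n)" using W openin_subset by blast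
  have CE: "C k t \<in> topspace (Euclidean_space n)" if "k \<le> n" for k t
    using c0 that by (auto simp: C_def topspace_Euclidean_space)
  have C0: "C k t0 = c t0" for k by (auto simp: C_def)
  have near: "\<forall>\<^sub>F t in nhds t0. \<forall>i<n. \<bar>c t i - c t0 i\<bar> < \<delta>" if "\<delta> > 0" for \<delta>
  proof -
    have "\<forall>\<^sub>F t in nhds t0. \<bar>c t i - c t0 i\<bar> < \<delta>" if "i < n" for i
    proof -
      have "((\<lambda>t. c t i) \<longlongrightarrow> c t0 i) (nhds t0)"
        using DERIV_isCont[OF c'[OF that]] by (simp add: isCont_def tendsto_at_iff_tendsto_nhds[of "\<lambda>t. c t i"])
      then show ?thesis using \<open>\<delta> > 0\<close> by (simp add: tendsto_iff dist_real_def)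
    qed
    then show ?thesis by (subst eventually_ball_finite_distrib[of "{..<n}", simplified Ball_def lessThan_iff]) auto
  qed
  have partial: "((\<lambda>s. f (a(k := s))) has_real_derivative partial_deriv k f (a(k := z))) (at z)"
    if "k < n" "a(k := z) \<in> W" for k a z
    using Ck_has_partial_deriv[of n 0 W f k "a(k := z)"] f that by simp
  have step: "((\<lambda>t. f (C (Suc k) t) - f (C k t)) has_real_derivative partial_deriv k f (c t0) * c' k) (at t0)"
    if k: "k < n" for k
  proof -
    \<comment> \<open>the difference quotient in the coordinate \<open>k\<close>, extended by its limit where \<open>c t k\<close> has not moved, so that the increment is \<open>K t * (c t k - c t0 k)\<close> for every \<open>t\<close>\<close>
    define K where "K t = (if c t k = c t0 k then partial_deriv k f (c t0)
      else (f (C (Suc k) t) - f (C k t)) / (c t k - c t0 k))" for t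
    have CS: "C (Suc k) t = (C k t)(k := c t k)" for t by (auto simp: C_def fun_eq_iff)
    have Cupd: "C k t = (C k t)(k := c t0 k)" for t by (auto simp: C_def fun_eq_iff)
    have diff: "f (C (Suc k) t) - f (C k t) = K t * (c t k - c t0 k)" for t
    proof (cases "c t k = c t0 k")
      case True
      then have "C (Suc k) t = C k t" using CS Cupd by metis
      then show ?thesis using True by simp
    qed (auto simp: K_def)
    have lim: "(K \<longlongrightarrow> partial_deriv k f (c t0)) (at t0)"
    proof (rule tendstoI)
      fix e :: real assume "e > 0"
      have "continuous_map (subtopology (Euclidean_space n) W) euclideanreal (partial_deriv k f)"
        using f k by auto
      then have "openin (subtopology (Euclidean_space n) W)
          {x \<in> topspace (subtopology (Euclidean_space n) W). partial_deriv k f x \<in> ball (partial_deriv k f (c t0)) e}"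
        by (rule openin_continuous_map_preimage) auto
      then have op: "openin (Euclidean_space n)
          {x \<in> topspace (subtopology (Euclidean_space n) W). partial_deriv k f x \<in> ball (partial_deriv k f (c t0)) e}"
        using W(1) openin_trans_full by blast
      obtain \<delta> where \<delta>: "\<delta> > 0"
        "\<And>x. x \<in> topspace (Euclidean_space n) \<Longrightarrow> (\<And>i. i < n \<Longrightarrow> \<bar>x i - c t0 i\<bar> < \<delta>) \<Longrightarrow>
          x \<in> W \<and> dist (partial_deriv k f x) (partial_deriv k f (c t0)) < e"
        using openin_Euclidean_box[OF op, of "c t0"] W(2) c0 \<open>e > 0\<close>
        by (auto simp: dist_commute)
      have "dist (K t) (partial_deriv k f (c t0)) < e" if t: "\<forall>i<n. \<bar>c t i - c t0 i\<bar> < \<delta>" for t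
      proof (cases "c t k = c t0 k")
        case True
        then show ?thesis using \<open>e > 0\<close> by (simp add: K_def)
      next
        case False
        have box: "(C k t)(k := z) \<in> W \<and> dist (partial_deriv k f ((C k t)(k := z))) (partial_deriv k f (c t0)) < e"
          if z: "\<bar>z - c t0 k\<bar> \<le> \<bar>c t k - c t0 k\<bar>" for z
        proof (rule \<delta>(2))
          show "(C k t)(k := z) \<in> topspace (Euclidean_space n)"
            using fun_upd_in_Euclidean CE k by auto
          show "\<bar>((C k t)(k := z)) i - c t0 i\<bar> < \<delta>" if "i < n" for i
            using t that z \<delta>(1) k by (auto simp: C_def intro: le_less_trans)
        qed
        obtain z where z: "\<bar>z - c t0 k\<bar> \<le> \<bar>c t k - c t0 k\<bar>"
          "f ((C k t)(k := c t k)) - f ((C k t)(k := c t0 k)) = partial_deriv k f ((C k t)(k := z)) * (c t k - c t0 k)"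
          using real_mean_value[of "c t0 k" "c t k" "\<lambda>s. f ((C k t)(k := s))"
              "\<lambda>z. partial_deriv k f ((C k t)(k := z))"] partial[OF k] box by metis
        have "K t = partial_deriv k f ((C k t)(k := z))"
          using z(2) False CS[of t] Cupd[of t] by (simp add: K_def)
        then show ?thesis using box[OF z(1)] by simp
      qed
      then have "\<forall>\<^sub>F t in nhds t0. dist (K t) (partial_deriv k f (c t0)) < e"
        using near[OF \<delta>(1)] by (auto elim: eventually_mono)
      then show "\<forall>\<^sub>F t in at t0. dist (K t) (partial_deriv k f (c t0)) < e"
        by (simp add: eventually_nhds_conv_at)
    qed
    have "((\<lambda>t. (c t k - c t0 k) / (t - t0)) \<longlongrightarrow> c' k) (at t0)"
      using c'[OF k] by (simp add: has_field_derivative_iff)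
    from tendsto_mult[OF lim this] show ?thesis
      by (simp add: has_field_derivative_iff diff)
  qed
  have "((\<lambda>t. f (C k t)) has_real_derivative (\<Sum>j<k. partial_deriv j f (c t0) * c' j)) (at t0)"
    if "k \<le> n" for k
    using that
  proof (induction k)
    case 0
    then show ?case by (simp add: C_def)
  next
    case (Suc k)
    then have "((\<lambda>t. f (C k t) + (f (C (Suc k) t) - f (C k t))) has_real_derivative
        (\<Sum>j<k. partial_deriv j f (c t0) * c' j) + partial_deriv k f (c t0) * c' k) (at t0)"
      by (intro DERIV_add step) auto
    then show ?case by simp
  qed
  then have "((\<lambda>t. f (C n t)) has_real_derivative (\<Sum>j<n. partial_deriv j f (c t0) * c' j)) (at t0)"
    by simp
  moreover have "\<forall>\<^sub>F t in nhds t0. f (C n t) = f (c t)"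
  proof (rule eventually_mono[OF cE])
    fix t assume "c t \<in> topspace (Euclidean_space n)"
    then have "C n t = c t" using c0 by (auto simp: C_def topspace_Euclidean_space fun_eq_iff)
    then show "f (C n t) = f (c t)" by simp
  qed
  ultimately show ?thesis by (subst (asm) DERIV_cong_ev) auto
qed

text \<open>A partial derivative at a point of an open set depends only on the values on that set. So \<open>Ck\<close> can
  be transferred between functions that agree there, although \<open>partial_deriv\<close> is defined for functions
  on all of \<open>nat \<Rightarrow> real\<close>.\<close>

lemma partial_deriv_cong_open:
  assumes "openin (Euclidean_space m) V" "\<And>y. y \<in> V \<Longrightarrow> f y = g y" "y \<in> V" "i < m"
  shows "partial_deriv i f y = partial_deriv i g y"
    and "(\<lambda>t. f (y(i := t))) differentiable (at (y i)) \<longleftrightarrow> (\<lambda>t. g (y(i := t))) differentiable (at (y i))"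
proof -
  have ev: "\<forall>\<^sub>F t in nhds (y i). f (y(i := t)) = g (y(i := t))"
    using eventually_fun_upd_in_open[OF assms(1,3,4)] assms(2) by (auto elim: eventually_mono)
  show "partial_deriv i f y = partial_deriv i g y"
    unfolding partial_deriv_def by (rule deriv_cong_ev[OF ev refl])
  show "(\<lambda>t. f (y(i := t))) differentiable (at (y i)) \<longleftrightarrow> (\<lambda>t. g (y(i := t))) differentiable (at (y i))"
    using DERIV_cong_ev[OF refl ev refl] by (auto simp: real_differentiable_def)
qed

lemma Ck_cong:
  assumes "openin (Euclidean_space m) V" "\<And>y. y \<in> V \<Longrightarrow> f y = g y"
  shows "Ck m k V f \<longleftrightarrow> Ck m k V g"
  using assms(2)
proof (induction k arbitrary: f g)
  case 0
  then show ?case by (auto intro: continuous_map_eq)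
next
  case (Suc k)
  have "continuous_map (subtopology (Euclidean_space m) V) euclideanreal f \<longleftrightarrow>
      continuous_map (subtopology (Euclidean_space m) V) euclideanreal g"
    using Suc.prems by (auto intro: continuous_map_eq)
  moreover have "Ck m k V (partial_deriv i f) \<longleftrightarrow> Ck m k V (partial_deriv i g)" if "i < m" for i
    using partial_deriv_cong_open(1)[OF assms(1), of f g] Suc.prems that by (intro Suc.IH) auto
  ultimately show ?case
    using partial_deriv_cong_open(2)[OF assms(1), of f g] Suc.prems by auto
qed

lemma Ck_continuous: "Ck m k V f \<Longrightarrow> continuous_map (subtopology (Euclidean_space m) V) euclideanreal f"
  by (cases k) auto

lemma Ck_Suc_imp: "Ck m (Suc k) V f \<Longrightarrow> Ck m k V f"
proof (induction k arbitrary: f)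
  case 0
  then show ?case by simp
next
  case (Suc k)
  then have "Ck m k V (partial_deriv i f)" if "i < m" for i
    using that Suc.IH Ck.simps(2)[of m "Suc k" V f] by blast
  then show ?case
    using Suc.prems Ck.simps(2)[of m "Suc k" V f] Ck.simps(2)[of m k V f] by blast
qed

lemma Ck_one: "Ck m (Suc k) V f \<Longrightarrow> Ck m 1 V f"
  by (auto dest: Ck_continuous)

lemma Ck_mono:
  assumes "V' \<subseteq> V" shows "Ck m k V f \<Longrightarrow> Ck m k V' f"
  using assms by (induction k arbitrary: f) (auto intro: continuous_map_from_subtopology_mono)

text \<open>Differentiability of finite order is a local property; only the continuity requirement needs an
  argument, which is the pasting lemma.\<close>

lemma Ck_Union:
  assumes "\<And>V. V \<in> \<V> \<Longrightarrow> openin (Euclidean_space m) V" "\<And>V. V \<in> \<V> \<Longrightarrow> Ck m k V f"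
  shows "Ck m k (\<Union>\<V>) f"
proof -
  have cont: "continuous_map (subtopology (Euclidean_space m) (\<Union>\<V>)) euclideanreal g"
    if "\<And>V. V \<in> \<V> \<Longrightarrow> continuous_map (subtopology (Euclidean_space m) V) euclideanreal g" for g
    apply (rule pasting_lemma[where I = \<V> and T = "\<lambda>V. V" and f = "\<lambda>_. g"])
    using that assms(1) openin_subset
    by (fastforce simp: subtopology_subtopology inf.absorb2 Sup_upper openin_subtopology_alt topspace_subtopology)+
  show ?thesis using assms(2)
  proof (induction k arbitrary: f)
    case 0
    then show ?case by (auto intro: cont)
  next
    case (Suc k)
    show ?case unfolding Ck.simps
    proof (intro conjI allI impI)
      show "continuous_map (subtopology (Euclidean_space m) (\<Union>\<V>)) euclideanreal f"
        using Suc.prems by (auto intro: cont)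
      fix i assume "i < m"
      then show "Ck m k (\<Union>\<V>) (partial_deriv i f)" using Suc.prems by (intro Suc.IH) auto
      show "\<forall>y\<in>\<Union>\<V>. (\<lambda>t. f (y(i := t))) differentiable (at (y i))"
        using Suc.prems \<open>i < m\<close> by auto
    qed
  qed
qed

lemma Ck_partial_deriv: "Ck m (Suc k) V f \<Longrightarrow> i < m \<Longrightarrow> Ck m k V (partial_deriv i f)"
  by simp

text \<open>Introduction of \<open>Ck\<close> by exhibiting the partial derivatives: the formula \<open>D\<close> has to be right on \<open>V\<close>
  only, whereas \<open>partial_deriv i f\<close> may differ from it elsewhere.\<close>

lemma Ck_SucI:
  assumes "openin (Euclidean_space m) V" "continuous_map (subtopology (Euclidean_space m) V) euclideanreal f"
    and "\<And>i y. i < m \<Longrightarrow> y \<in> V \<Longrightarrow> ((\<lambda>t. f (y(i := t))) has_real_derivative D i y) (at (y i))"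
    and "\<And>i. i < m \<Longrightarrow> Ck m k V (D i)"
  shows "Ck m (Suc k) V f"
proof -
  have "Ck m k V (partial_deriv i f)" if "i < m" for i
    using assms(4)[OF that] Ck_cong[OF assms(1), of "partial_deriv i f" "D i"] assms(3)[OF that]
    by (auto simp: partial_deriv_def DERIV_imp_deriv)
  then show ?thesis using assms(2,3) by (auto simp: real_differentiable_def)
qed

lemma Ck_const: "openin (Euclidean_space m) V \<Longrightarrow> Ck m k V (\<lambda>y. a)"
  by (induction k arbitrary: a) (auto intro!: Ck_SucI[where D = "\<lambda>_ _. 0"] simp del: Ck.simps(2))

lemma Ck_add:
  assumes V: "openin (Euclidean_space m) V"
  shows "Ck m k V f \<Longrightarrow> Ck m k V g \<Longrightarrow> Ck m k V (\<lambda>y. f y + g y)"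
proof (induction k arbitrary: f g)
  case 0
  then show ?case by (simp add: continuous_map_add)
next
  case (Suc k)
  show ?case
  proof (rule Ck_SucI[OF V, where D = "\<lambda>i y. partial_deriv i f y + partial_deriv i g y"])
    show "continuous_map (subtopology (Euclidean_space m) V) euclideanreal (\<lambda>y. f y + g y)"
      by (rule continuous_map_add[OF Ck_continuous[OF Suc.prems(1)] Ck_continuous[OF Suc.prems(2)]])
    show "Ck m k V (\<lambda>y. partial_deriv i f y + partial_deriv i g y)" if "i < m" for i
      by (rule Suc.IH[OF Ck_partial_deriv[OF Suc.prems(1) that] Ck_partial_deriv[OF Suc.prems(2) that]])
    show "((\<lambda>t. f (y(i := t)) + g (y(i := t))) has_real_derivative
        partial_deriv i f y + partial_deriv i g y) (at (y i))" if "i < m" "y \<in> V" for i y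
      using DERIV_add[OF Ck_has_partial_deriv[OF Suc.prems(1) that] Ck_has_partial_deriv[OF Suc.prems(2) that]] .
  qed
qed

lemma Ck_mult:
  assumes V: "openin (Euclidean_space m) V"
  shows "Ck m k V f \<Longrightarrow> Ck m k V g \<Longrightarrow> Ck m k V (\<lambda>y. f y * g y)"
proof (induction k arbitrary: f g)
  case 0
  show ?case using continuous_map_real_mult[OF Ck_continuous[OF 0(1)] Ck_continuous[OF 0(2)]] by simp
next
  case (Suc k)
  show ?case
  proof (rule Ck_SucI[OF V, where D = "\<lambda>i y. f y * partial_deriv i g y + partial_deriv i f y * g y"])
    show "continuous_map (subtopology (Euclidean_space m) V) euclideanreal (\<lambda>y. f y * g y)"
      by (rule continuous_map_real_mult[OF Ck_continuous[OF Suc.prems(1)] Ck_continuous[OF Suc.prems(2)]])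
    show "Ck m k V (\<lambda>y. f y * partial_deriv i g y + partial_deriv i f y * g y)" if "i < m" for i
    proof (rule Ck_add[OF V])
      show "Ck m k V (\<lambda>y. f y * partial_deriv i g y)"
        by (rule Suc.IH[OF Ck_Suc_imp[OF Suc.prems(1)] Ck_partial_deriv[OF Suc.prems(2) that]])
      show "Ck m k V (\<lambda>y. partial_deriv i f y * g y)"
        by (rule Suc.IH[OF Ck_partial_deriv[OF Suc.prems(1) that] Ck_Suc_imp[OF Suc.prems(2)]])
    qed
    show "((\<lambda>t. f (y(i := t)) * g (y(i := t))) has_real_derivative
        f y * partial_deriv i g y + partial_deriv i f y * g y) (at (y i))" if "i < m" "y \<in> V" for i y
    proof (rule DERIV_cong)
      show "((\<lambda>t. f (y(i := t)) * g (y(i := t))) has_real_derivative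
          f (y(i := y i)) * partial_deriv i g y + partial_deriv i f y * g (y(i := y i))) (at (y i))"
        by (rule DERIV_mult'[OF Ck_has_partial_deriv[OF Suc.prems(1) that] Ck_has_partial_deriv[OF Suc.prems(2) that]])
    qed simp
  qed
qed

lemma Ck_sum:
  assumes "openin (Euclidean_space m) V" "\<And>j. j < r \<Longrightarrow> Ck m k V (f j)"
  shows "Ck m k V (\<lambda>y. \<Sum>j<(r::nat). f j y)"
  using assms(2)
proof (induction r)
  case 0
  show ?case using Ck_const[OF assms(1)] by simp
next
  case (Suc r)
  then show ?case using Ck_add[OF assms(1), of k "\<lambda>y. \<Sum>j<r. f j y" "f r"] by simp
qed

lemma continuous_map_into_Euclidean:
  assumes "\<And>i. i < n \<Longrightarrow> continuous_map X euclideanreal (\<lambda>y. g y i)"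
    and "g \<in> topspace X \<rightarrow> topspace (Euclidean_space n) \<inter> W"
  shows "continuous_map X (subtopology (Euclidean_space n) W) g"
proof -
  have "continuous_map X euclideanreal (\<lambda>y. g y i)" for i
  proof (cases "i < n")
    case False
    then have "\<And>y. y \<in> topspace X \<Longrightarrow> 0 = g y i"
      using assms(2) by (force simp: topspace_Euclidean_space Pi_iff)
    then show ?thesis
      by (rule continuous_map_eq[OF continuous_map_const[THEN iffD2], rotated]) auto
  qed (use assms in auto)
  then have "continuous_map X (powertop_real UNIV) g"
    by (simp add: continuous_map_componentwise_UNIV)
  moreover have "g \<in> topspace X \<rightarrow> W" "g \<in> topspace X \<rightarrow> {x. \<forall>i\<ge>n. x i = 0}"
    using assms(2) by (auto simp: topspace_Euclidean_space)
  ultimately show ?thesis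
    unfolding Euclidean_space_def continuous_map_in_subtopology by blast
qed

text \<open>By induction on the order: the chain rule writes the partial derivatives of \<open>f \<circ> g\<close> as sums of
  products of \<open>\<partial>\<^sub>j f \<circ> g\<close>, which the induction hypothesis covers, and of \<open>\<partial>\<^sub>i g\<^sub>j\<close>.\<close>

lemma Ck_compose:
  assumes V: "openin (Euclidean_space m) V" and W: "openin (Euclidean_space n) W"
    and gW: "\<And>y. y \<in> V \<Longrightarrow> g y \<in> W"
  shows "(\<And>j. j < n \<Longrightarrow> Ck m k V (\<lambda>y. g y j)) \<Longrightarrow> Ck n k W f \<Longrightarrow> Ck m k V (\<lambda>y. f (g y))"
proof (induction k arbitrary: f)
  case 0
  have "continuous_map (subtopology (Euclidean_space m) V) (subtopology (Euclidean_space n) W) g"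
    using gW openin_subset[OF V] openin_subset[OF W] 0 by (intro continuous_map_into_Euclidean) auto
  from continuous_map_compose[OF this] 0 show ?case by (auto simp: o_def)
next
  case (Suc k)
  have "continuous_map (subtopology (Euclidean_space m) V) (subtopology (Euclidean_space n) W) g"
    using gW openin_subset[OF V] openin_subset[OF W] Suc.prems by (intro continuous_map_into_Euclidean) auto
  from continuous_map_compose[OF this Ck_continuous[OF Suc.prems(2)]]
  have cont: "continuous_map (subtopology (Euclidean_space m) V) euclideanreal (\<lambda>y. f (g y))"
    by (simp add: o_def)
  show ?case
  proof (rule Ck_SucI[OF V cont, where D = "\<lambda>i y. \<Sum>j<n. partial_deriv j f (g y) * partial_deriv i (\<lambda>y. g y j) y"])
    fix i assume i: "i < m"
    show "Ck m k V (\<lambda>y. \<Sum>j<n. partial_deriv j f (g y) * partial_deriv i (\<lambda>y. g y j) y)"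
    proof (intro Ck_sum[OF V] Ck_mult[OF V])
      fix j assume j: "j < n"
      show "Ck m k V (\<lambda>y. partial_deriv j f (g y))"
        by (rule Suc.IH[OF Ck_Suc_imp[OF Suc.prems(1)] Ck_partial_deriv[OF Suc.prems(2) j]])
      show "Ck m k V (partial_deriv i (\<lambda>y. g y j))" using Suc.prems(1)[OF j] i by auto
    qed
    fix y assume y: "y \<in> V"
    have "((\<lambda>t. f (g (y(i := t)))) has_real_derivative
        (\<Sum>j<n. partial_deriv j f (g (y(i := y i))) * partial_deriv i (\<lambda>y. g y j) y)) (at (y i))"
    proof (rule has_derivative_along_curve[OF W])
      show "g (y(i := y i)) \<in> W" using gW y by simp
      show "Ck n 1 W f" using Ck_one Suc.prems(2) .
      show "\<forall>\<^sub>F t in nhds (y i). g (y(i := t)) \<in> topspace (Euclidean_space n)"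
        by (rule eventually_mono[OF eventually_fun_upd_in_open[OF V y i]])
          (use gW openin_subset[OF W] in blast)
      show "((\<lambda>t. g (y(i := t)) j) has_real_derivative partial_deriv i (\<lambda>y. g y j) y) (at (y i))"
        if "j < n" for j
        using Ck_has_partial_deriv[OF Suc.prems(1)[OF that] i y] .
    qed
    then show "((\<lambda>t. f (g (y(i := t)))) has_real_derivative
        (\<Sum>j<n. partial_deriv j f (g y) * partial_deriv i (\<lambda>y. g y j) y)) (at (y i))" by simp
  qed
qed

section \<open>Smooth functions on manifolds\<close>

lemma chart:
  assumes "smooth_manifold M" "(U, \<xi>) \<in> mfd_atlas M"
  shows chart_domain_open: "openin (mfd_top M) U"
    and chart_inj: "inj_on \<xi> U"
    and chart_image_open: "openin (mfd_top M) W \<Longrightarrow> openin (Euclidean_space (mfd_dim M)) (\<xi> ` (U \<inter> W))"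
proof -
  show U: "openin (mfd_top M) U" using assms unfolding smooth_manifold_def by blast
  have im: "openin (Euclidean_space (mfd_dim M)) (\<xi> ` U)"
    and hom: "homeomorphic_map (subtopology (mfd_top M) U)
          (subtopology (Euclidean_space (mfd_dim M)) (\<xi> ` U)) \<xi>"
    using assms unfolding smooth_manifold_def by blast+
  have top: "topspace (subtopology (mfd_top M) U) = U" using openin_subset[OF U] by auto
  show "inj_on \<xi> U" using homeomorphic_imp_injective_map[OF hom] top by simp
  assume "openin (mfd_top M) W"
  then have "openin (subtopology (mfd_top M) U) (U \<inter> W)" by (simp add: openin_subtopology_Int2)
  then have "openin (subtopology (Euclidean_space (mfd_dim M)) (\<xi> ` U)) (\<xi> ` (U \<inter> W))"
    using homeomorphic_map_openness[OF hom, of "U \<inter> W"] top by blast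
  then show "openin (Euclidean_space (mfd_dim M)) (\<xi> ` (U \<inter> W))"
    using im openin_trans_full by blast
qed

lemma smooth_realI:
  assumes "\<And>U \<xi> k. (U, \<xi>) \<in> mfd_atlas M \<Longrightarrow>
    Ck (mfd_dim M) k (\<xi> ` (U \<inter> W)) (\<lambda>y. f (inv_into U \<xi> y))"
  shows "smooth_real M W f"
  using assms unfolding smooth_real_def smooth_on_Euclidean_def by blast

lemma smooth_realD:
  "smooth_real M W f \<Longrightarrow> (U, \<xi>) \<in> mfd_atlas M \<Longrightarrow>
    Ck (mfd_dim M) k (\<xi> ` (U \<inter> W)) (\<lambda>y. f (inv_into U \<xi> y))"
  unfolding smooth_real_def smooth_on_Euclidean_def by blast

lemma smooth_real_mono:
  assumes "smooth_real M W f" "W' \<subseteq> W"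
  shows "smooth_real M W' f"
proof (rule smooth_realI)
  fix U \<xi> k assume "(U, \<xi>) \<in> mfd_atlas M"
  then show "Ck (mfd_dim M) k (\<xi> ` (U \<inter> W')) (\<lambda>y. f (inv_into U \<xi> y))"
    using assms(2) by (intro Ck_mono[OF _ smooth_realD[OF assms(1)]]) auto
qed

lemma smooth_real_cong:
  assumes M: "smooth_manifold M" and W: "openin (mfd_top M) W"
    and f: "smooth_real M W f" and eq: "\<And>x. x \<in> W \<Longrightarrow> f x = g x"
  shows "smooth_real M W g"
proof (rule smooth_realI)
  fix U \<xi> k assume ch: "(U, \<xi>) \<in> mfd_atlas M"
  have "f (inv_into U \<xi> y) = g (inv_into U \<xi> y)" if "y \<in> \<xi> ` (U \<inter> W)" for y
    using that chart_inj[OF M ch] eq by auto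
  then show "Ck (mfd_dim M) k (\<xi> ` (U \<inter> W)) (\<lambda>y. g (inv_into U \<xi> y))"
    using Ck_cong[OF chart_image_open[OF M ch W], of "\<lambda>y. f (inv_into U \<xi> y)" "\<lambda>y. g (inv_into U \<xi> y)" k]
      smooth_realD[OF f ch] by blast
qed

lemma smooth_real_mult:
  assumes "smooth_manifold M" "openin (mfd_top M) W" "smooth_real M W f" "smooth_real M W g"
  shows "smooth_real M W (\<lambda>x. f x * g x)"
  by (rule smooth_realI, rule Ck_mult[OF chart_image_open[OF assms(1) _ assms(2)]
        smooth_realD[OF assms(3)] smooth_realD[OF assms(4)]])

lemma smooth_real_sum:
  assumes "smooth_manifold M" "openin (mfd_top M) W" "\<And>j. j < r \<Longrightarrow> smooth_real M W (f j)"
  shows "smooth_real M W (\<lambda>x. \<Sum>j<(r::nat). f j x)"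
  by (rule smooth_realI, rule Ck_sum[OF chart_image_open[OF assms(1) _ assms(2)]
        smooth_realD[OF assms(3)]])

lemma smooth_real_Union:
  assumes M: "smooth_manifold M" and op: "\<And>W. W \<in> \<W> \<Longrightarrow> openin (mfd_top M) W"
    and f: "\<And>W. W \<in> \<W> \<Longrightarrow> smooth_real M W f"
  shows "smooth_real M (\<Union>\<W>) f"
proof (rule smooth_realI)
  fix U \<xi> k assume ch: "(U, \<xi>) \<in> mfd_atlas M"
  have "Ck (mfd_dim M) k (\<Union>((\<lambda>W. \<xi> ` (U \<inter> W)) ` \<W>)) (\<lambda>y. f (inv_into U \<xi> y))"
    using chart_image_open[OF M ch op] smooth_realD[OF f ch] by (intro Ck_Union) auto
  moreover have "\<Union>((\<lambda>W. \<xi> ` (U \<inter> W)) ` \<W>) = \<xi> ` (U \<inter> \<Union>\<W>)" by blast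
  ultimately show "Ck (mfd_dim M) k (\<xi> ` (U \<inter> \<Union>\<W>)) (\<lambda>y. f (inv_into U \<xi> y))" by simp
qed

text \<open>In a chart \<open>\<xi>\<close> of \<open>M\<close> and over the domain of a chart \<open>\<eta>\<close> of \<open>N\<close>, the function \<open>f \<circ> \<phi>\<close> factors as
  \<open>(f \<circ> \<eta>\<^sup>-\<^sup>1) \<circ> (\<eta> \<circ> \<phi> \<circ> \<xi>\<^sup>-\<^sup>1)\<close>, where smoothness of both factors is what the definitions provide. The
  preimages of the charts of \<open>N\<close> cover, and smoothness is local.\<close>

lemma smooth_real_compose:
  assumes M: "smooth_manifold M" and N: "smooth_manifold N" and \<phi>: "smooth_map M N \<phi>"
    and W: "openin (mfd_top N) W" and f: "smooth_real N W f"
  shows "smooth_real M {x \<in> points M. \<phi> x \<in> W} (\<lambda>x. f (\<phi> x))"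
proof -
  have cont: "continuous_map (mfd_top M) (mfd_top N) \<phi>" using \<phi> by (simp add: smooth_map_def)
  define P where "P V = {x \<in> points M. \<phi> x \<in> V \<inter> W}" for V
  have P_open: "openin (mfd_top M) (P V)" if "(V, \<eta>) \<in> mfd_atlas N" for V \<eta>
    unfolding P_def
    by (intro openin_continuous_map_preimage[OF cont] openin_Int W chart_domain_open[OF N that])
  have P_smooth: "smooth_real M (P V) (\<lambda>x. f (\<phi> x))" if V: "(V, \<eta>) \<in> mfd_atlas N" for V \<eta>
  proof (rule smooth_realI)
    fix U \<xi> k assume ch: "(U, \<xi>) \<in> mfd_atlas M"
    define g where "g y = \<eta> (\<phi> (inv_into U \<xi> y))" for y
    let ?D = "\<xi> ` (U \<inter> P V)"
    have D: "openin (Euclidean_space (mfd_dim M)) ?D" by (rule chart_image_open[OF M ch P_open[OF V]])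
    have pt: "\<phi> (inv_into U \<xi> y) \<in> V \<inter> W" if "y \<in> ?D" for y
      using that chart_inj[OF M ch] by (auto simp: P_def)
    have "Ck (mfd_dim M) k ?D (\<lambda>y. f (inv_into V \<eta> (g y)))"
    proof (rule Ck_compose[OF D chart_image_open[OF N V W], where g = g and f = "\<lambda>z. f (inv_into V \<eta> z)"])
      show "g y \<in> \<eta> ` (V \<inter> W)" if "y \<in> ?D" for y using pt[OF that] by (auto simp: g_def)
      show "Ck (mfd_dim M) k ?D (\<lambda>y. g y j)" if "j < mfd_dim N" for j
      proof -
        have "smooth_real M {x \<in> points M. \<phi> x \<in> V} (\<lambda>x. \<eta> (\<phi> x) j)"
          using \<phi> V that unfolding smooth_map_def by blast
        then have "smooth_real M (P V) (\<lambda>x. \<eta> (\<phi> x) j)"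
          by (rule smooth_real_mono) (auto simp: P_def)
        from smooth_realD[OF this ch] show ?thesis by (simp add: g_def)
      qed
      show "Ck (mfd_dim N) k (\<eta> ` (V \<inter> W)) (\<lambda>z. f (inv_into V \<eta> z))"
        by (rule smooth_realD[OF f V])
    qed
    moreover have "f (inv_into V \<eta> (g y)) = f (\<phi> (inv_into U \<xi> y))" if "y \<in> ?D" for y
      using pt[OF that] chart_inj[OF N V] by (simp add: g_def)
    ultimately show "Ck (mfd_dim M) k ?D (\<lambda>y. f (\<phi> (inv_into U \<xi> y)))"
      using Ck_cong[OF D, of "\<lambda>y. f (inv_into V \<eta> (g y))" "\<lambda>y. f (\<phi> (inv_into U \<xi> y))" k] by blast
  qed
  have "smooth_real M (\<Union>(P ` fst ` mfd_atlas N)) (\<lambda>x. f (\<phi> x))"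
    using P_open P_smooth by (intro smooth_real_Union[OF M]) auto
  moreover have "\<Union>(P ` fst ` mfd_atlas N) = {x \<in> points M. \<phi> x \<in> W}"
  proof -
    have "\<Union>(fst ` mfd_atlas N) = points N" using N by (simp add: smooth_manifold_def)
    then show ?thesis using openin_subset[OF W] by (fastforce simp: P_def)
  qed
  ultimately show ?thesis by simp
qed

lemma pullback_fun_Cinf:
  assumes "smooth_manifold M" "smooth_manifold N" "smooth_map M N \<phi>" "f \<in> Cinf N"
  shows "pullback_fun M \<phi> f \<in> Cinf M"
proof -
  have "\<phi> x \<in> points N" if "x \<in> points M" for x
    using assms(3) that by (auto simp: smooth_map_def continuous_map_def)
  then have "{x \<in> points M. \<phi> x \<in> points N} = points M" by auto
  then have "smooth_real M (points M) (\<lambda>x. f (\<phi> x))"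
    using smooth_real_compose[OF assms(1-3) openin_topspace, of f] assms(4) by (simp add: Cinf_def)
  then have "smooth_real M (points M) (pullback_fun M \<phi> f)"
    by (rule smooth_real_cong[OF assms(1) openin_topspace]) (simp add: pullback_fun_def)
  then show ?thesis by (simp add: Cinf_def pullback_fun_def)
qed

section \<open>Pulling back sections\<close>

text \<open>A linear functional is determined by its values on a basis. The space \<open>V\<close> is known only through its
  linear coordinate isomorphism \<open>t\<close>, so the partial sums of the basis expansion of \<open>e\<close> are built
  inside \<open>V\<close> and recognised by their coordinates. The last one equals \<open>e\<close> because \<open>t\<close> is injective.\<close>

lemma linear_functional_in_coordinates:
  assumes bij: "bij_betw t (carrier V) (carrier (coordinate_space r))"
    and t: "linear_map V (coordinate_space r) t"
    and add_closed: "\<And>x y. x \<in> carrier V \<Longrightarrow> y \<in> carrier V \<Longrightarrow> x \<oplus>\<^bsub>V\<^esub> y \<in> carrier V"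
    and smult_closed: "\<And>c x. x \<in> carrier V \<Longrightarrow> c \<odot>\<^bsub>V\<^esub> x \<in> carrier V"
    and L_add: "\<And>x y. x \<in> carrier V \<Longrightarrow> y \<in> carrier V \<Longrightarrow> L (x \<oplus>\<^bsub>V\<^esub> y) = L x + L y"
    and L_smult: "\<And>c x. x \<in> carrier V \<Longrightarrow> L (c \<odot>\<^bsub>V\<^esub> x) = c * L x"
    and e: "e \<in> carrier V"
  shows "L e = (\<Sum>j<r. t e j * (L (inv_into (carrier V) t (unit_vec j)) :: real))"
proof -
  define b where "b j = inv_into (carrier V) t (unit_vec j)" for j
  have t_add: "t (x \<oplus>\<^bsub>V\<^esub> y) = (\<lambda>i. t x i + t y i)" if "x \<in> carrier V" "y \<in> carrier V" for x y
    using t that by (simp add: linear_map_def coordinate_space_def)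
  have t_smult: "t (c \<odot>\<^bsub>V\<^esub> x) = (\<lambda>i. c * t x i)" if "x \<in> carrier V" for c x
    using t that by (simp add: linear_map_def coordinate_space_def)
  have te: "\<forall>i\<ge>r. t e i = 0"
    using t e by (auto simp: linear_map_def coordinate_space_def topspace_Euclidean_space Pi_iff)
  have b: "b j \<in> carrier V" "t (b j) = unit_vec j" if "j < r" for j
  proof -
    have "unit_vec j \<in> t ` carrier V"
      using that bij by (auto simp: bij_betw_def coordinate_space_def topspace_Euclidean_space unit_vec_def)
    then show "b j \<in> carrier V" "t (b j) = unit_vec j"
      by (auto simp: b_def inv_into_into f_inv_into_f)
  qed
  have "\<exists>x\<in>carrier V. t x = (\<lambda>i. if i < k then t e i else 0) \<and> L x = (\<Sum>j<k. t e j * L (b j))"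
    if "k \<le> r" for k
    using that
  proof (induction k)
    case 0
    then show ?case
      \<comment> \<open>\<open>0 \<odot> e\<close> serves as zero vector: its coordinates and its image under \<open>L\<close> are evident by linearity\<close>
      using e by (intro bexI[of _ "0 \<odot>\<^bsub>V\<^esub> e"]) (auto simp: t_smult L_smult smult_closed)
  next
    case (Suc k)
    then obtain x where x: "x \<in> carrier V" "t x = (\<lambda>i. if i < k then t e i else 0)"
      "L x = (\<Sum>j<k. t e j * L (b j))" by auto
    have "k < r" using Suc by simp
    let ?y = "t e k \<odot>\<^bsub>V\<^esub> b k"
    have "t (x \<oplus>\<^bsub>V\<^esub> ?y) = (\<lambda>i. if i < Suc k then t e i else 0)"
      using x b[OF \<open>k < r\<close>] by (auto simp: t_add t_smult smult_closed unit_vec_def fun_eq_iff less_Suc_eq)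
    moreover have "L (x \<oplus>\<^bsub>V\<^esub> ?y) = (\<Sum>j<Suc k. t e j * L (b j))"
      using x b[OF \<open>k < r\<close>] by (simp add: L_add L_smult smult_closed)
    ultimately show ?case
      using x(1) b(1)[OF \<open>k < r\<close>] add_closed smult_closed by blast
  qed
  then obtain x where x: "x \<in> carrier V" "t x = (\<lambda>i. if i < r then t e i else 0)"
    "L x = (\<Sum>j<r. t e j * L (b j))" by blast
  have "t x = t e" using x(2) te by (auto simp: fun_eq_iff)
  then have "x = e" using bij x(1) e by (auto simp: bij_betw_def inj_on_def)
  then show ?thesis using x(3) by (simp add: b_def)
qed

lemma fibre_pullback_bundle:
  assumes "x \<in> points M"
  shows "carrier (fibre (pullback_bundle M \<phi> E) x) = Pair x ` carrier (fibre E (\<phi> x))"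
  using assms by (auto simp: fibre_def pullback_bundle_def)

lemma fibre_ops [simp]:
  "add (fibre E x) = vb_add E" "smult (fibre E x) = vb_scale E"
  by (simp_all add: fibre_def)

lemma pullback_bundle_ops [simp]:
  "vb_add (pullback_bundle M \<phi> E) (x, e) (x', e') = (x, vb_add E e e')"
  "vb_scale (pullback_bundle M \<phi> E) c (x, e) = (x, vb_scale E c e)"
  by (simp_all add: pullback_bundle_def)

lemma bundle_map_pullback_fibre:
  assumes \<Phi>: "bundle_map M (pullback_bundle M \<phi> E2) E1 \<Phi>" and x: "x \<in> points M"
    and e: "e \<in> carrier (fibre E2 (\<phi> x))"
  shows "\<Phi> (x, e) \<in> carrier (fibre E1 x)"
    and "e' \<in> carrier (fibre E2 (\<phi> x)) \<Longrightarrow> \<Phi> (x, vb_add E2 e e') = vb_add E1 (\<Phi> (x, e)) (\<Phi> (x, e'))"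
    and "\<Phi> (x, vb_scale E2 c e) = vb_scale E1 c (\<Phi> (x, e))"
proof -
  have lin: "linear_map (fibre (pullback_bundle M \<phi> E2) x) (fibre E1 x) \<Phi>"
    using \<Phi> x by (simp add: bundle_map_def)
  have mem: "(x, e) \<in> carrier (fibre (pullback_bundle M \<phi> E2) x)" if "e \<in> carrier (fibre E2 (\<phi> x))" for e
    using that by (simp add: fibre_pullback_bundle[OF x])
  show "\<Phi> (x, e) \<in> carrier (fibre E1 x)"
    using lin mem[OF e] by (auto simp: linear_map_def)
  show "\<Phi> (x, vb_scale E2 c e) = vb_scale E1 c (\<Phi> (x, e))"
    using lin mem[OF e] by (force simp: linear_map_def)
  show "\<Phi> (x, vb_add E2 e e') = vb_add E1 (\<Phi> (x, e)) (\<Phi> (x, e'))" if "e' \<in> carrier (fibre E2 (\<phi> x))"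
    using lin mem[OF e] mem[OF that] by (force simp: linear_map_def)
qed

lemma vector_bundle_closed:
  assumes E: "vector_bundle M E" and x: "x \<in> points M" and e: "e \<in> carrier (fibre E x)"
  shows "e' \<in> carrier (fibre E x) \<Longrightarrow> vb_add E e e' \<in> carrier (fibre E x)"
    and "vb_scale E c e \<in> carrier (fibre E x)"
proof -
  have "(\<forall>e\<in>carrier (fibre E x). \<forall>e'\<in>carrier (fibre E x). vb_add E e e' \<in> carrier (fibre E x)) \<and>
      (\<forall>c. \<forall>e\<in>carrier (fibre E x). vb_scale E c e \<in> carrier (fibre E x))"
    using E x by (simp add: vector_bundle_def)
  then show "e' \<in> carrier (fibre E x) \<Longrightarrow> vb_add E e e' \<in> carrier (fibre E x)"
    and "vb_scale E c e \<in> carrier (fibre E x)"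
    using e by blast+
qed

lemma trivialisation:
  assumes E: "vector_bundle M E" and t: "(U, t) \<in> vb_trivs E"
  shows triv_domain_open: "openin (mfd_top M) U"
    and triv_bij: "x \<in> U \<Longrightarrow> bij_betw t (carrier (fibre E x)) (carrier (coordinate_space (vb_rank E)))"
    and triv_linear: "x \<in> U \<Longrightarrow> linear_map (fibre E x) (coordinate_space (vb_rank E)) t"
proof -
  have *: "\<forall>(U,t)\<in>vb_trivs E. openin (mfd_top M) U \<and>
      (\<forall>x\<in>U. bij_betw t (carrier (fibre E x)) (carrier (coordinate_space (vb_rank E))) \<and>
             linear_map (fibre E x) (coordinate_space (vb_rank E)) t \<and> t (vb_zero E x) = (\<lambda>i. 0))"
    using E by (simp add: vector_bundle_def)
  show "openin (mfd_top M) U"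
    and "x \<in> U \<Longrightarrow> bij_betw t (carrier (fibre E x)) (carrier (coordinate_space (vb_rank E)))"
    and "x \<in> U \<Longrightarrow> linear_map (fibre E x) (coordinate_space (vb_rank E)) t"
    using bspec[OF * t] by auto
qed

lemma sections_fibre: "\<sigma> \<in> sections M E \<Longrightarrow> x \<in> points M \<Longrightarrow> \<sigma> x \<in> carrier (fibre E x)"
  by (simp add: sections_def)

text \<open>The local formula for \<open>\<Phi>\<close>, with coefficients that are smooth by the definition of a bundle map: the
  functional \<open>s\<^sub>i \<circ> \<Phi>\<close> on the fibre of the pull-back bundle is evaluated on the frame induced by \<open>t\<close>.\<close>

lemma bundle_map_in_frame:
  assumes E1: "vector_bundle M E1" and E2: "vector_bundle N E2"
    and \<Phi>: "bundle_map M (pullback_bundle M \<phi> E2) E1 \<Phi>"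
    and s: "(V, s) \<in> vb_trivs E1" and t: "(U, t) \<in> vb_trivs E2"
    and x: "x \<in> V" "\<phi> x \<in> U" and e: "e \<in> carrier (fibre E2 (\<phi> x))"
  shows "s (\<Phi> (x, e)) i =
    (\<Sum>j<vb_rank E2. t e j * s (\<Phi> (frame (pullback_bundle M \<phi> E2) (\<lambda>(x, e). t e) j x)) i)"
proof -
  let ?E = "pullback_bundle M \<phi> E2"
  have xM: "x \<in> points M" using openin_subset[OF triv_domain_open[OF E1 s]] x(1) by blast
  have xN: "\<phi> x \<in> points N" using openin_subset[OF triv_domain_open[OF E2 t]] x(2) by blast
  note F = fibre_pullback_bundle[OF xM, of \<phi> E2]
  note s_lin = triv_linear[OF E1 s x(1)]
  note t_lin = triv_linear[OF E2 t x(2)]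
  have "s (\<Phi> (x, e)) i = (\<Sum>j<vb_rank E2. (\<lambda>(x, e). t e) (x, e) j *
      s (\<Phi> (inv_into (carrier (fibre ?E x)) (\<lambda>(x, e). t e) (unit_vec j))) i)"
  proof (rule linear_functional_in_coordinates[where L = "\<lambda>w. s (\<Phi> w) i"])
    show "bij_betw (\<lambda>(x, e). t e) (carrier (fibre ?E x)) (carrier (coordinate_space (vb_rank E2)))"
      using triv_bij[OF E2 t x(2)] unfolding F bij_betw_def by (auto simp: inj_on_def image_image)
    show "linear_map (fibre ?E x) (coordinate_space (vb_rank E2)) (\<lambda>(x, e). t e)"
      using t_lin unfolding linear_map_def F by auto
    show "(x, e) \<in> carrier (fibre ?E x)" using e F by auto
    show "w \<oplus>\<^bsub>fibre ?E x\<^esub> w' \<in> carrier (fibre ?E x)"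
      if "w \<in> carrier (fibre ?E x)" "w' \<in> carrier (fibre ?E x)" for w w'
      using that vector_bundle_closed[OF E2 xN] unfolding F by auto
    show "c \<odot>\<^bsub>fibre ?E x\<^esub> w \<in> carrier (fibre ?E x)" if "w \<in> carrier (fibre ?E x)" for c w
      using that vector_bundle_closed[OF E2 xN] unfolding F by auto
    show "s (\<Phi> (w \<oplus>\<^bsub>fibre ?E x\<^esub> w')) i = s (\<Phi> w) i + s (\<Phi> w') i"
      if "w \<in> carrier (fibre ?E x)" "w' \<in> carrier (fibre ?E x)" for w w'
      using that s_lin bundle_map_pullback_fibre[OF \<Phi> xM]
      unfolding F by (auto simp: linear_map_def coordinate_space_def)
    show "s (\<Phi> (c \<odot>\<^bsub>fibre ?E x\<^esub> w)) i = c * s (\<Phi> w) i" if "w \<in> carrier (fibre ?E x)" for c w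
      using that s_lin bundle_map_pullback_fibre[OF \<Phi> xM]
      unfolding F by (auto simp: linear_map_def coordinate_space_def)
  qed
  then show ?thesis by (simp add: frame_def)
qed

text \<open>Over the preimage of a trivialising set of \<open>E2\<close>, the components of the pulled back section are sums of
  products of a component of \<open>\<sigma>\<close> composed with \<open>\<phi>\<close> and a matrix entry of \<open>\<Phi>\<close>; both are smooth, and
  these preimages cover the base.\<close>

lemma pullback_section_in_sections:
  assumes M: "smooth_manifold M" and N: "smooth_manifold N"
    and E1: "vector_bundle M E1" and E2: "vector_bundle N E2"
    and \<phi>: "smooth_map M N \<phi>" and \<Phi>: "bundle_map M (pullback_bundle M \<phi> E2) E1 \<Phi>"
    and \<sigma>: "\<sigma> \<in> sections N E2"
  shows "pullback_section M \<phi> \<Phi> \<sigma> \<in> sections M E1"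
proof -
  have cont: "continuous_map (mfd_top M) (mfd_top N) \<phi>" using \<phi> by (simp add: smooth_map_def)
  then have \<phi>N: "\<phi> x \<in> points N" if "x \<in> points M" for x
    using that by (auto simp: continuous_map_def)
  have "smooth_real M V (\<lambda>x. s (pullback_section M \<phi> \<Phi> \<sigma> x) i)"
    if s: "(V, s) \<in> vb_trivs E1" and i: "i < vb_rank E1" for V s i
  proof -
    note V = triv_domain_open[OF E1 s]
    define P where "P U = {x \<in> points M. \<phi> x \<in> U} \<inter> V" for U
    have P_open: "openin (mfd_top M) (P U)" if "(U, t) \<in> vb_trivs E2" for U t
      unfolding P_def
      by (intro openin_Int V openin_continuous_map_preimage[OF cont] triv_domain_open[OF E2 that])
    have P_smooth: "smooth_real M (P U) (\<lambda>x. s (pullback_section M \<phi> \<Phi> \<sigma> x) i)"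
      if t: "(U, t) \<in> vb_trivs E2" for U t
    proof -
      have "smooth_real M (P U) (\<lambda>x. \<Sum>j<vb_rank E2. t (\<sigma> (\<phi> x)) j *
          s (\<Phi> (frame (pullback_bundle M \<phi> E2) (\<lambda>(x, e). t e) j x)) i)"
      proof (intro smooth_real_sum[OF M] smooth_real_mult[OF M] P_open[OF t])
        fix j assume j: "j < vb_rank E2"
        have "smooth_real N U (\<lambda>y. t (\<sigma> y) j)" using \<sigma> t j unfolding sections_def by blast
        from smooth_real_compose[OF M N \<phi> triv_domain_open[OF E2 t] this]
        show "smooth_real M (P U) (\<lambda>x. t (\<sigma> (\<phi> x)) j)"
          by (rule smooth_real_mono) (auto simp: P_def)
        have "({x \<in> points M. \<phi> x \<in> U}, \<lambda>(x, e). t e) \<in> vb_trivs (pullback_bundle M \<phi> E2)"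
          using t by (force simp: pullback_bundle_def)
        moreover have "j < vb_rank (pullback_bundle M \<phi> E2)" using j by (simp add: pullback_bundle_def)
        ultimately show "smooth_real M (P U)
            (\<lambda>x. s (\<Phi> (frame (pullback_bundle M \<phi> E2) (\<lambda>(x, e). t e) j x)) i)"
          using \<Phi> s i unfolding bundle_map_def P_def by blast
      qed
      then show ?thesis
      proof (rule smooth_real_cong[OF M P_open[OF t]])
        fix x assume x: "x \<in> P U"
        then have "x \<in> points M" by (simp add: P_def)
        then show "(\<Sum>j<vb_rank E2. t (\<sigma> (\<phi> x)) j *
            s (\<Phi> (frame (pullback_bundle M \<phi> E2) (\<lambda>(x, e). t e) j x)) i) =
          s (pullback_section M \<phi> \<Phi> \<sigma> x) i"
          using bundle_map_in_frame[OF E1 E2 \<Phi> s t _ _ sections_fibre[OF \<sigma> \<phi>N], of x i] x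
          by (simp add: P_def pullback_section_def)
      qed
    qed
    have "smooth_real M (\<Union>(P ` fst ` vb_trivs E2)) (\<lambda>x. s (pullback_section M \<phi> \<Phi> \<sigma> x) i)"
      using P_open P_smooth by (intro smooth_real_Union[OF M]) auto
    moreover have "\<Union>(P ` fst ` vb_trivs E2) = V"
    proof -
      have "\<Union>(fst ` vb_trivs E2) = points N" using E2 by (simp add: vector_bundle_def)
      then show ?thesis using openin_subset[OF V] \<phi>N by (fastforce simp: P_def)
    qed
    ultimately show ?thesis by simp
  qed
  moreover have "pullback_section M \<phi> \<Phi> \<sigma> x \<in> carrier (fibre E1 x)" if "x \<in> points M" for x
    using bundle_map_pullback_fibre(1)[OF \<Phi> that sections_fibre[OF \<sigma> \<phi>N[OF that]]] that
    by (simp add: pullback_section_def)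
  moreover have "pullback_section M \<phi> \<Phi> \<sigma> \<in> extensional (points M)"
    by (simp add: pullback_section_def)
  ultimately show ?thesis unfolding sections_def by blast
qed

section \<open>Anchors and related vector fields\<close>

text \<open>Skew-multilinear maps are constrained by linearity in each slot, and it is this linearity that puts
  their values into the target space. So \<open>k > 0\<close> is what ensures that the anchor takes its values in
  the tangent bundle.\<close>

lemma anchor_field_tangent:
  assumes \<rho>: "exterior_bundle_map M k E (tangent_bundle M) \<rho>" and k: "k > 0"
    and Xs: "Xs \<in> args k (sections M E)" and x: "x \<in> points M"
  shows "fst (anchor_field M \<rho> Xs x) = x"
    and "snd (anchor_field M \<rho> Xs x) \<in> extensional (Cinf M)"
proof -
  let ?es = "map (\<lambda>X. X x) Xs"
  have es: "?es \<in> args k (carrier (fibre E x))"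
    using Xs sections_fibre[OF _ x] by (auto simp: args_def)
  moreover have "skew_multilinear k (fibre E x) (fibre (tangent_bundle M) x) \<rho>"
    using \<rho> x by (simp add: exterior_bundle_map_def)
  ultimately have "linear_map (fibre E x) (fibre (tangent_bundle M) x) (\<lambda>e. \<rho> (?es[0 := e]))"
    using k by (auto simp: skew_multilinear_def)
  moreover have "?es ! 0 \<in> carrier (fibre E x)"
    using es k nth_mem[of 0 ?es] unfolding args_def by auto
  ultimately have "\<rho> (?es[0 := ?es ! 0]) \<in> carrier (fibre (tangent_bundle M) x)"
    unfolding linear_map_def by blast
  then have "anchor_field M \<rho> Xs x \<in> carrier (fibre (tangent_bundle M) x)"
    using x by (simp only: list_update_id anchor_field_def restrict_apply')
  then show "fst (anchor_field M \<rho> Xs x) = x"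
    and "snd (anchor_field M \<rho> Xs x) \<in> extensional (Cinf M)"
    by (auto simp: fibre_def tangent_bundle_def tangent_space_def)
qed

text \<open>A tangent vector is the derivation given by its action on smooth functions, and the tangent map acts
  by precomposition with the pull-back of functions. Relatedness of vector fields is therefore an
  equality of derivations, which can be tested on functions one at a time.\<close>

lemma related_iff_pullback_fun:
  fixes M :: "'a mfd" and N :: "'b mfd"
  assumes "\<And>x. x \<in> points M \<Longrightarrow> fst (X x) = x" "\<And>x. x \<in> points M \<Longrightarrow> \<phi> x \<in> points N"
    and "\<And>y. y \<in> points N \<Longrightarrow> fst (Y y) = y \<and> snd (Y y) \<in> extensional (Cinf N)"
  shows "related M N \<phi> X Y \<longleftrightarrow>
    (\<forall>f\<in>Cinf N. pullback_fun M \<phi> (vf_apply N Y f) = vf_apply M X (pullback_fun M \<phi> f))"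
proof -
  have "tangent_map M N \<phi> (X x) = Y (\<phi> x) \<longleftrightarrow>
      (\<forall>f\<in>Cinf N. snd (Y (\<phi> x)) f = snd (X x) (pullback_fun M \<phi> f))" if x: "x \<in> points M" for x
  proof -
    have T: "tangent_map M N \<phi> (X x) = (\<phi> x, \<lambda>f\<in>Cinf N. snd (X x) (pullback_fun M \<phi> f))"
      using assms(1)[OF x] by (simp add: tangent_map_def split_beta)
    have ext: "restrict h (Cinf N) = v \<longleftrightarrow> (\<forall>f\<in>Cinf N. v f = h f)"
      if "v \<in> extensional (Cinf N)" for h v :: "('b \<Rightarrow> real) \<Rightarrow> real"
      using that by (auto simp: extensional_def fun_eq_iff restrict_def)
    have Y: "fst (Y (\<phi> x)) = \<phi> x" "snd (Y (\<phi> x)) \<in> extensional (Cinf N)"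
      using assms(3)[OF assms(2)[OF x]] by simp_all
    show ?thesis
      unfolding T prod_eq_iff fst_conv snd_conv Y(1) ext[OF Y(2)] by simp
  qed
  then show ?thesis
    using assms(2)
    by (auto simp: related_def vf_apply_def pullback_fun_def fun_eq_iff restrict_def)
qed

theorem corollary5p4:
  fixes n :: nat
    and M :: "'m mfd" and E1 :: "('m, 'e1) vbundle"
    and \<rho>1 :: "'e1 list \<Rightarrow> 'm \<times> (('m \<Rightarrow> real) \<Rightarrow> real)"
    and br1 :: "('m \<Rightarrow> 'e1) list \<Rightarrow> ('m \<Rightarrow> 'e1)"
    and N :: "'n mfd" and E2 :: "('n, 'e2) vbundle"
    and \<rho>2 :: "'e2 list \<Rightarrow> 'n \<times> (('n \<Rightarrow> real) \<Rightarrow> real)"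
    and br2 :: "('n \<Rightarrow> 'e2) list \<Rightarrow> ('n \<Rightarrow> 'e2)"
    and \<phi> :: "'m \<Rightarrow> 'n" and \<Phi> :: "'m \<times> 'e2 \<Rightarrow> 'e1"
    and \<psi> :: "('n \<Rightarrow> real) \<Rightarrow> ('m \<Rightarrow> real)"
  assumes "n_Lie_algebroid n M E1 \<rho>1 br1"
    and "n_Lie_algebroid n N E2 \<rho>2 br2"
    and "smooth_map M N \<phi>"
    and "bundle_map M (pullback_bundle M \<phi> E2) E1 \<Phi>"
    and "\<psi> = pullback_fun M \<phi>"
  shows "(anchor_compatible n M \<rho>1 N E2 \<rho>2 \<phi> \<Phi> \<longleftrightarrow>
      (\<forall>\<sigma>s\<in>args (n - 1) (sections N E2). \<forall>f\<in>Cinf N.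
        \<psi> (fun_bracket N \<rho>2 \<sigma>s f) =
        fun_bracket M \<rho>1 (map (pullback_section M \<phi> \<Phi>) \<sigma>s) (\<psi> f))) \<and>
    (comorphism n M E1 \<rho>1 br1 N E2 \<rho>2 br2 \<phi> \<Phi> \<longleftrightarrow>
      lie_rinehart_morphism n (section_lie_rinehart N E2 \<rho>2 br2)
        (section_lie_rinehart M E1 \<rho>1 br1) (pullback_section M \<phi> \<Phi>) \<psi>)"
proof -
  have n: "n - 1 > 0" and M: "smooth_manifold M" and N: "smooth_manifold N"
    and E1: "vector_bundle M E1" and E2: "vector_bundle N E2"
    and \<rho>1: "exterior_bundle_map M (n - 1) E1 (tangent_bundle M) \<rho>1"
    and \<rho>2: "exterior_bundle_map N (n - 1) E2 (tangent_bundle N) \<rho>2"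
    using assms(1,2) by (simp_all add: n_Lie_algebroid_def)
  note \<phi> = assms(3) and \<Phi> = assms(4) and \<psi> = assms(5)
  let ?\<Psi> = "pullback_section M \<phi> \<Phi>"
  have \<phi>N: "\<phi> x \<in> points N" if "x \<in> points M" for x
    using \<phi> that by (auto simp: smooth_map_def continuous_map_def)
  note \<Psi> = pullback_section_in_sections[OF M N E1 E2 \<phi> \<Phi>]
  have related: "related M N \<phi> (anchor_field M \<rho>1 (map ?\<Psi> \<sigma>s)) (anchor_field N \<rho>2 \<sigma>s) \<longleftrightarrow>
      (\<forall>f\<in>Cinf N. \<psi> (fun_bracket N \<rho>2 \<sigma>s f) = fun_bracket M \<rho>1 (map ?\<Psi> \<sigma>s) (\<psi> f))"
    if \<sigma>s: "\<sigma>s \<in> args (n - 1) (sections N E2)" for \<sigma>s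
    unfolding fun_bracket_def \<psi>
  proof (rule related_iff_pullback_fun)
    have "map ?\<Psi> \<sigma>s \<in> args (n - 1) (sections M E1)"
      using \<sigma>s \<Psi> by (auto simp: args_def)
    then show "fst (anchor_field M \<rho>1 (map ?\<Psi> \<sigma>s) x) = x" if "x \<in> points M" for x
      using anchor_field_tangent(1)[OF \<rho>1 n _ that] by blast
    show "fst (anchor_field N \<rho>2 \<sigma>s y) = y \<and> snd (anchor_field N \<rho>2 \<sigma>s y) \<in> extensional (Cinf N)"
      if "y \<in> points N" for y
      using anchor_field_tangent[OF \<rho>2 n \<sigma>s that] by blast
  qed (rule \<phi>N)
  have anchor: "anchor_compatible n M \<rho>1 N E2 \<rho>2 \<phi> \<Phi> \<longleftrightarrow>
      (\<forall>\<sigma>s\<in>args (n - 1) (sections N E2). \<forall>f\<in>Cinf N.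
        \<psi> (fun_bracket N \<rho>2 \<sigma>s f) = fun_bracket M \<rho>1 (map ?\<Psi> \<sigma>s) (\<psi> f))"
    unfolding anchor_compatible_def using related by (rule ball_cong[OF refl])
  have \<psi>_Cinf: "\<psi> f \<in> Cinf M" if "f \<in> Cinf N" for f
    using pullback_fun_Cinf[OF M N \<phi> that] by (simp add: \<psi>)
  \<comment> \<open>The remaining clauses of a morphism, which concern the pull-backs themselves, hold for every smooth map and every bundle map.\<close>
  have algebra_hom: "\<psi> \<in> ring_hom (Cinf_algebra N) (Cinf_algebra M)"
    "linear_map (Cinf_algebra N) (Cinf_algebra M) \<psi>"
    using \<psi>_Cinf \<phi>N
    by (auto simp: ring_hom_def linear_map_def Cinf_algebra_def \<psi> pullback_fun_def fun_eq_iff restrict_def)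
  have \<Psi>_add: "?\<Psi> (X \<oplus>\<^bsub>section_module N E2\<^esub> Y) = ?\<Psi> X \<oplus>\<^bsub>section_module M E1\<^esub> ?\<Psi> Y"
    if "X \<in> sections N E2" "Y \<in> sections N E2" for X Y
  proof
    show "?\<Psi> (X \<oplus>\<^bsub>section_module N E2\<^esub> Y) x = (?\<Psi> X \<oplus>\<^bsub>section_module M E1\<^esub> ?\<Psi> Y) x" for x
      using bundle_map_pullback_fibre(2)[OF \<Phi> _ sections_fibre[OF that(1) \<phi>N] sections_fibre[OF that(2) \<phi>N], of x]
      by (cases "x \<in> points M") (auto simp: section_module_def pullback_section_def \<phi>N)
  qed
  have \<Psi>_smult: "?\<Psi> (f \<odot>\<^bsub>section_module N E2\<^esub> X) = \<psi> f \<odot>\<^bsub>section_module M E1\<^esub> ?\<Psi> X"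
    if "X \<in> sections N E2" for f X
  proof
    show "?\<Psi> (f \<odot>\<^bsub>section_module N E2\<^esub> X) x = (\<psi> f \<odot>\<^bsub>section_module M E1\<^esub> ?\<Psi> X) x" for x
      using bundle_map_pullback_fibre(3)[OF \<Phi> _ sections_fibre[OF that(1) \<phi>N], of x "f (\<phi> x)"]
      by (cases "x \<in> points M") (auto simp: section_module_def pullback_section_def \<phi>N \<psi> pullback_fun_def)
  qed
  have carriers: "carrier (section_module N E2) = sections N E2"
    "carrier (section_module M E1) = sections M E1" "carrier (Cinf_algebra N) = Cinf N"
    by (simp_all add: section_module_def Cinf_algebra_def)
  have "comorphism n M E1 \<rho>1 br1 N E2 \<rho>2 br2 \<phi> \<Phi> \<longleftrightarrow>
      lie_rinehart_morphism n (section_lie_rinehart N E2 \<rho>2 br2)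
        (section_lie_rinehart M E1 \<rho>1 br1) ?\<Psi> \<psi>"
    using algebra_hom \<Psi> \<Psi>_add \<Psi>_smult \<phi> \<Phi>
    by (simp add: comorphism_def lie_rinehart_morphism_def section_lie_rinehart_def carriers anchor Pi_iff)
  with anchor show ?thesis by blast
qed

end
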